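(* Let $f:\mathbb{R}^2\to[0,+\infty)$ be a function whose graph is closed in $\mathbb{R}^2\times[0,+\infty)$, and suppose that the set $D_f$ of all points of discontinuity of $f$ is a network. Then the graph of $f$ is disconnected.
   Context: $D_f$ is the set of points of $\mathbb{R}^2$ at which $f$ is not continuous. The graph of $f$ is $\{(x,f(x)):x\in\mathbb{R}^2\}$ with the subspace topology of the product $\mathbb{R}^2\times[0,+\infty)$. An arc is a set homeomorphic to $[0,1]$; the symbol $[a,b]$ (possibly with an index, $[a,b]_i$) denotes a chosen arc with endpoints $a$ and $b$. A set $E\subset\mathbb{R}^2$ is a network iff there are arcs $[a_1,b_1]_1,\dots,[a_n,b_n]_n\subset\mathbb{R}^2$ such that: (1) $E=\bigcup_{i=1}^n[a_i,b_i]_i$; (2) $[a_1,b_1]_1\cup[a_2,b_2]_2$ is homeomorphic to the unit circle; (3) $[a_k,b_k]_k\cap\bigcup_{i=1}^{k-1}[a_i,b_i]_i=\{a_k,b_k\}$ for $k=2,\dots,n$. *)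

theory Defs
  imports "HOL-Analysis.Analysis"
begin

definition graph_of :: "('a \<Rightarrow> 'b) \<Rightarrow> ('a \<times> 'b) set" where
  "graph_of f = {(x, f x) | x. x \<in> UNIV}"

definition discontinuities :: "('a::t2_space \<Rightarrow> 'b::topological_space) \<Rightarrow> 'a set" where
  "discontinuities f = {x. \<not> isCont f x}"

(* Arcs are point sets here; the library predicate "arc" is about parametrizations. *)
definition arc_between :: "'a::topological_space set \<Rightarrow> 'a \<Rightarrow> 'a \<Rightarrow> bool" where
  "arc_between A a b \<longleftrightarrow>
     (\<exists>h h'. homeomorphism {0..1::real} A h h' \<and> h 0 = a \<and> h 1 = b)"

lemma arc_between_iff_arc:
  fixes A :: "'a::t2_space set"
  shows "arc_between A a b \<longleftrightarrow>
           (\<exists>g. arc g \<and> path_image g = A \<and> pathstart g = a \<and> pathfinish g = b)"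
proof
  assume "arc_between A a b"
  then obtain h h' where h: "homeomorphism {0..1::real} A h h'" "h 0 = a" "h 1 = b"
    unfolding arc_between_def by blast
  have "arc h"
    using h(1) unfolding arc_def path_def homeomorphism_def
    by (metis inj_on_inverseI)
  moreover have "path_image h = A"
    using h(1) by (simp add: path_image_def homeomorphism_def)
  ultimately show "\<exists>g. arc g \<and> path_image g = A \<and> pathstart g = a \<and> pathfinish g = b"
    using h(2,3) by (auto simp: pathstart_def pathfinish_def)
next
  assume "\<exists>g. arc g \<and> path_image g = A \<and> pathstart g = a \<and> pathfinish g = b"
  then obtain g where g: "arc g" "path_image g = A" "g 0 = a" "g 1 = b"
    by (auto simp: pathstart_def pathfinish_def)
  then obtain g' where "homeomorphism {0..1} A g g'"
    using homeomorphism_compact[of "{0..1::real}" g A]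
    by (auto simp: arc_def path_def path_image_def)
  then show "arc_between A a b"
    using g unfolding arc_between_def by blast
qed

(* A i is the chosen arc with endpoints a i and b i; n >= 2 because the second
   clause refers to the first two arcs. *)
definition network :: "(real^2) set \<Rightarrow> bool" where
  "network E \<longleftrightarrow>
     (\<exists>(n::nat) (A::nat \<Rightarrow> (real^2) set) (a::nat \<Rightarrow> real^2) (b::nat \<Rightarrow> real^2).
        2 \<le> n \<and>
        (\<forall>i\<in>{1..n}. arc_between (A i) (a i) (b i)) \<and>
        E = (\<Union>i\<in>{1..n}. A i) \<and>
        (A 1 \<union> A 2) homeomorphic sphere (0::real^2) 1 \<and>
        (\<forall>k\<in>{2..n}. A k \<inter> (\<Union>i\<in>{1..k - 1}. A i) = {a k, b k}))"

end

theory Submission imports Defs begin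

text \<open>
  The network is moved to the complex plane and drawn as a plane graph with a set of edges \<open>EE\<close> and
  a set of vertices \<open>P\<close>. Every arc of a network that is attached after the first one splits a face, so
  that \<open>card EE + 2 \<le> card P + (number of faces)\<close> (\<open>plane_net_Euler\<close>).

  Each face reaches each point \<open>p\<close> of the network in a single branch
  (\<open>same_component_near\<close>, an application of Janiszewski's theorem). As the graph of \<open>f\<close> is closed, \<open>f\<close>
  restricted to a face \<open>U\<close> can accumulate at \<open>p\<close> only at \<open>f p\<close> and at infinity; by the intermediate
  value theorem on the single branch it does not do both (\<open>blow_up_if_not_tame\<close>). Call \<open>U\<close> tame at
  \<open>p\<close> if \<open>f\<close> is bounded on \<open>U\<close> near \<open>p\<close>. An interior point of an edge is touched by only two faces,
  and if both were tame there, \<open>f\<close> would be bounded near that point and hence continuous at it. So at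
  most one face is tame at such a point (\<open>unique_tame_face\<close>).

  Consequently pieces of the graph of \<open>f\<close> over different faces can be connected only through the points
  over the vertices. This is recorded in a finite system of links between faces and vertices: a face is
  linked to a vertex where it is tame, and the two ends of an edge are linked if no face is tame at any
  interior point of that edge (the graph of \<open>f\<close> over such an edge may be connected). A face that is
  tame at \<open>v\<close> borders two edges at \<open>v\<close>, is tame on them near \<open>v\<close>, and therefore shares neither of these
  two edge ends with another face that is tame at \<open>v\<close>. Counting edge ends shows that there are at
  most \<open>card EE\<close> links (\<open>card_tame_corners\<close>), while by the inequality above there are at least
  \<open>card EE + 2\<close> faces and vertices. Hence the faces and vertices have a two-colouring that is constant
  along links (\<open>colouring\<close>), and it extends to a nonconstant, locally constant function on the graph
  of \<open>f\<close> (\<open>graph_not_connected\<close>).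
\<close>

section \<open>Arcs\<close>

lemma arc_between_sym:
  fixes A :: "'a::t2_space set"
  assumes "arc_between A a b"
  shows "arc_between A b a"
proof -
  obtain g where "arc g" "path_image g = A" "pathstart g = a" "pathfinish g = b"
    using assms arc_between_iff_arc by blast
  then have "arc (reversepath g)" "path_image (reversepath g) = A"
    "pathstart (reversepath g) = b" "pathfinish (reversepath g) = a"
    by (auto simp: arc_reversepath)
  then show ?thesis
    using arc_between_iff_arc by blast
qed

lemma arc_between_basic:
  fixes A :: "'a::t2_space set"
  assumes "arc_between A a b"
  shows "a \<in> A" "b \<in> A" "a \<noteq> b" "compact A" "connected A" "path_connected A" "closed A"
proof -
  obtain g where g: "arc g" "path_image g = A" "pathstart g = a" "pathfinish g = b"
    using assms arc_between_iff_arc by blast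
  show "a \<in> A" "b \<in> A" "a \<noteq> b" "compact A" "connected A" "path_connected A"
    using g arc_distinct_ends[OF g(1)] compact_arc_image[OF g(1)] connected_arc_image[OF g(1)]
    by (auto simp: arc_imp_path path_connected_path_image)
  then show "closed A" by (simp add: compact_imp_closed)
qed

lemma arc_between_subpath:
  fixes g :: "real \<Rightarrow> 'a::{t2_space,real_normed_vector}"
  assumes "arc g" "0 \<le> u" "u < v" "v \<le> 1"
  shows "arc_between (g ` {u..v}) (g u) (g v)"
proof -
  have "arc (subpath u v g)"
    using assms by (intro arc_subpath_arc) auto
  moreover have "path_image (subpath u v g) = g ` {u..v}"
    using assms by (simp add: path_image_subpath)
  ultimately show ?thesis
    using arc_between_iff_arc by (metis pathstart_subpath pathfinish_subpath)
qed

lemma arc_between_split: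
  fixes A :: "'a::real_normed_vector set"
  assumes "arc_between A a b" "c \<in> A" "c \<noteq> a" "c \<noteq> b"
  obtains A1 A2 where "arc_between A1 a c" "arc_between A2 c b" "A = A1 \<union> A2" "A1 \<inter> A2 = {c}"
proof -
  obtain g where g: "arc g" "path_image g = A" "g 0 = a" "g 1 = b"
    using assms by (auto simp: arc_between_iff_arc pathstart_def pathfinish_def)
  have inj: "inj_on g {0..1}" using g(1) by (simp add: arc_def)
  obtain t where t: "t \<in> {0..1}" "g t = c"
    using assms g by (auto simp: path_image_def)
  with assms g have t': "0 < t" "t < 1"
    by (metis atLeastAtMost_iff le_less)+
  have U: "A = g ` {0..t} \<union> g ` {t..1}"
    using t t' g(2) by (metis atLeastAtMost_iff image_Un ivl_disj_un_two_touch(4) path_image_def)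
  have I: "g ` {0..t} \<inter> g ` {t..1} = {c}"
  proof -
    have "g ` {0..t} \<inter> g ` {t..1} = g ` ({0..t} \<inter> {t..1})"
      using inj_on_image_Int[OF inj, of "{0..t}" "{t..1}"] t' by auto
    moreover have "{0..t} \<inter> {t..1} = {t}" using t' by auto
    ultimately show ?thesis using t by simp
  qed
  show ?thesis
    using arc_between_subpath[OF g(1), of 0 t] arc_between_subpath[OF g(1), of t 1] t t' g U I that
    by simp
qed

lemma arc_between_interior:
  fixes A :: "'a::real_normed_vector set"
  assumes "arc_between A a b"
  shows "connected (A - {a,b})" "A - {a,b} \<noteq> {}" "a \<in> closure (A - {a,b})"
proof -
  obtain g where g: "arc g" "path_image g = A" "g 0 = a" "g 1 = b"
    using assms by (auto simp: arc_between_iff_arc pathstart_def pathfinish_def)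
  have inj: "inj_on g {0..1}" and cont: "continuous_on {0..1} g"
    using g(1) by (auto simp: arc_def path_def)
  have eq: "A - {a,b} = g ` {0<..<1}"
  proof -
    have "g ` ({0..1} - {0,1}) = g ` {0..1} - g ` {0,1}"
      using inj by (intro inj_on_image_set_diff[of _ "{0..1}"]) auto
    moreover have "{0..1} - {0,1::real} = {0<..<1}" by auto
    ultimately show ?thesis using g by (simp add: path_image_def)
  qed
  show "connected (A - {a,b})"
    unfolding eq by (rule connected_continuous_image)
      (auto intro: continuous_on_subset[OF cont])
  show "A - {a,b} \<noteq> {}" unfolding eq by simp
  have "g 0 \<in> g ` closure {0<..<1}" by simp
  also have "\<dots> \<subseteq> closure (g ` {0<..<1})"
    using cont by (intro image_closure_subset) (auto intro: closure_subset[THEN subsetD])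
  finally show "a \<in> closure (A - {a,b})" unfolding eq g .
qed

lemma arc_between_cut_end:
  fixes A :: "'a::real_normed_vector set"
  assumes "arc_between A a b" "r > 0"
  obtains K where "closed K" "connected K" "b \<in> K" "K \<subseteq> A" "a \<notin> K" "A - K \<subseteq> ball a r"
proof -
  obtain g where g: "arc g" "path_image g = A" "g 0 = a" "g 1 = b"
    using assms by (auto simp: arc_between_iff_arc pathstart_def pathfinish_def)
  have inj: "inj_on g {0..1}" and cont: "continuous_on {0..1} g"
    using g(1) by (auto simp: arc_def path_def)
  obtain d where d: "d > 0" "\<And>x. x \<in> {0..1} \<Longrightarrow> dist x 0 < d \<Longrightarrow> dist (g x) (g 0) < r"
    using cont \<open>r > 0\<close> unfolding continuous_on_iff by (metis atLeastAtMost_iff order_refl zero_le_one)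
  define t where "t = min (1/2) (d/2)"
  have t: "0 < t" "t < 1" "t < d" using d(1) by (auto simp: t_def)
  have arc: "arc_between (g ` {t..1}) (g t) (g 1)"
    using arc_between_subpath[OF g(1), of t 1] t by simp
  show ?thesis
  proof
    show "closed (g ` {t..1})" "connected (g ` {t..1})" "b \<in> g ` {t..1}"
      using arc_between_basic[OF arc] g by auto
    show "g ` {t..1} \<subseteq> A" using g t by (auto simp: path_image_def)
    show "a \<notin> g ` {t..1}"
    proof
      assume "a \<in> g ` {t..1}"
      then obtain s where "s \<in> {t..1}" "g s = g 0" using g by auto
      with inj t show False by (auto dest!: inj_onD[of g "{0..1}" s 0])
    qed
    show "A - g ` {t..1} \<subseteq> ball a r"
    proof
      fix x assume x: "x \<in> A - g ` {t..1}"
      then obtain s where s: "s \<in> {0..1}" "x = g s" "s \<notin> {t..1}"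
        using g(2) unfolding path_image_def by blast
      then have "dist (g s) (g 0) < r" using t by (intro d(2)) auto
      then show "x \<in> ball a r" using s g by (simp add: dist_commute)
    qed
  qed
qed

section \<open>Sets whose faces have one branch at a point\<close>

text \<open>
  An arbitrarily small part of \<open>S\<close> around \<open>p\<close> can be cut out without disconnecting the rest. This is
  the condition under which Janiszewski's theorem shows that no component of \<open>- S\<close> approaches \<open>p\<close>
  along two different branches. It fails, for instance, at the double point of a figure eight.
\<close>

definition removable_germ :: "'a::metric_space set \<Rightarrow> 'a \<Rightarrow> bool" where
  "removable_germ S p \<longleftrightarrow>
     (\<forall>r>0. \<exists>K. closed K \<and> connected K \<and> K \<subseteq> S \<and> p \<notin> K \<and> S - K \<subseteq> ball p r)"

lemma removable_germ_small:
  assumes "d > 0"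
    and "\<And>r. 0 < r \<Longrightarrow> r \<le> d \<Longrightarrow> \<exists>K. closed K \<and> connected K \<and> K \<subseteq> S \<and> p \<notin> K \<and> S - K \<subseteq> ball p r"
  shows "removable_germ S p"
  unfolding removable_germ_def
proof (intro allI impI)
  fix r :: real assume "r > 0"
  then obtain K where "closed K \<and> connected K \<and> K \<subseteq> S \<and> p \<notin> K \<and> S - K \<subseteq> ball p (min r d)"
    using assms(2)[of "min r d"] assms(1) by auto
  then show "\<exists>K. closed K \<and> connected K \<and> K \<subseteq> S \<and> p \<notin> K \<and> S - K \<subseteq> ball p r"
    by (intro exI[of _ K]) (auto simp: subset_iff)
qed

lemma removable_germ_arc_end:
  fixes A :: "'a::real_normed_vector set"
  assumes "arc_between A a b"
  shows "removable_germ A a"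
  unfolding removable_germ_def
proof (intro allI impI)
  fix r :: real assume "r > 0"
  then obtain K where "closed K" "connected K" "b \<in> K" "K \<subseteq> A" "a \<notin> K" "A - K \<subseteq> ball a r"
    using arc_between_cut_end[OF assms] by blast
  then show "\<exists>K. closed K \<and> connected K \<and> K \<subseteq> A \<and> a \<notin> K \<and> A - K \<subseteq> ball a r"
    by blast
qed

text \<open>
  What remains of \<open>S\<close> contains \<open>a\<close> or \<open>b\<close>, namely one that is different from \<open>p\<close>, and what remains of
  the chord \<open>A\<close> hangs on it.
\<close>

lemma removable_germ_add_old:
  fixes S :: "'a::real_normed_vector set"
  assumes S: "removable_germ S p" "p \<in> S" and A: "arc_between A a b" "A \<inter> S = {a,b}"
  shows "removable_germ (S \<union> A) p"
proof -
  have main: "removable_germ (S \<union> A) p"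
    if A: "arc_between A a b" "A \<inter> S = {a,b}" and pb: "p \<noteq> b" for a b
  proof -
    have ab: "a \<in> S" "b \<in> S" "a \<noteq> b" "a \<in> A" "b \<in> A" "closed A" "connected A"
      using A arc_between_basic by fastforce+
    show ?thesis
    proof (cases "p = a")
      case True
      show ?thesis
      proof (rule removable_germ_small)
        show "dist p b > 0" using pb by simp
        fix r :: real assume r: "0 < r" "r \<le> dist p b"
        obtain K where K: "closed K" "connected K" "K \<subseteq> S" "p \<notin> K" "S - K \<subseteq> ball p r"
          using S r(1) unfolding removable_germ_def by blast
        obtain L where L: "closed L" "connected L" "b \<in> L" "L \<subseteq> A" "a \<notin> L" "A - L \<subseteq> ball a r"
          using arc_between_cut_end[OF A(1) r(1)] .
        have "b \<in> K" using K(5) ab r by auto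
        then have "connected (K \<union> L)" using K L by (intro connected_Un) auto
        then show "\<exists>K. closed K \<and> connected K \<and> K \<subseteq> S \<union> A \<and> p \<notin> K \<and> S \<union> A - K \<subseteq> ball p r"
          using K L True by (intro exI[of _ "K \<union> L"]) auto
      qed
    next
      case False
      then have "p \<notin> A" using S(2) A pb by auto
      show ?thesis
      proof (rule removable_germ_small)
        show "dist p b > 0" using pb by simp
        fix r :: real assume r: "0 < r" "r \<le> dist p b"
        obtain K where K: "closed K" "connected K" "K \<subseteq> S" "p \<notin> K" "S - K \<subseteq> ball p r"
          using S r(1) unfolding removable_germ_def by blast
        have "b \<in> K" using K(5) ab r by auto
        then have "connected (K \<union> A)" using K ab by (intro connected_Un) auto
        then show "\<exists>K. closed K \<and> connected K \<and> K \<subseteq> S \<union> A \<and> p \<notin> K \<and> S \<union> A - K \<subseteq> ball p r"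
          using K ab \<open>p \<notin> A\<close> by (intro exI[of _ "K \<union> A"]) auto
      qed
    qed
  qed
  show ?thesis
  proof (cases "p = b")
    case True
    then have "p \<noteq> a" using arc_between_basic(3)[OF A(1)] by simp
    then show ?thesis using main[OF arc_between_sym[OF A(1)]] A(2) by (simp add: insert_commute)
  qed (use main A in auto)
qed

text \<open>
  At an interior point of the chord both remaining pieces of the chord stay attached to \<open>S\<close>.
\<close>

lemma removable_germ_add_new:
  fixes S :: "'a::real_normed_vector set"
  assumes S: "connected S" "closed S" and A: "arc_between A a b" "A \<inter> S = {a,b}"
    and p: "p \<in> A" "p \<notin> S"
  shows "removable_germ (S \<union> A) p"
  unfolding removable_germ_def
proof (intro allI impI)
  fix r :: real assume r: "r > 0"
  have "p \<noteq> a" "p \<noteq> b" using A p by auto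
  then obtain A1 A2 where A12: "arc_between A1 a p" "arc_between A2 p b" "A = A1 \<union> A2"
    using arc_between_split[OF A(1) p(1)] by metis
  obtain L where L: "closed L" "connected L" "a \<in> L" "L \<subseteq> A1" "p \<notin> L" "A1 - L \<subseteq> ball p r"
    using arc_between_cut_end[OF arc_between_sym[OF A12(1)] r] .
  obtain M where M: "closed M" "connected M" "b \<in> M" "M \<subseteq> A2" "p \<notin> M" "A2 - M \<subseteq> ball p r"
    using arc_between_cut_end[OF A12(2) r] .
  have "a \<in> S" "b \<in> S" using A by auto
  then have "connected (S \<union> L)" using S L by (intro connected_Un) auto
  then have "connected ((S \<union> L) \<union> M)" using M \<open>b \<in> S\<close> by (intro connected_Un[of "S \<union> L"]) auto
  then show "\<exists>K. closed K \<and> connected K \<and> K \<subseteq> S \<union> A \<and> p \<notin> K \<and> S \<union> A - K \<subseteq> ball p r"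
    using S L M A12 p by (intro exI[of _ "(S \<union> L) \<union> M"]) auto
qed

text \<open>
  Let \<open>K\<close> be \<open>S\<close> without a small piece around \<open>p\<close>. Near \<open>p\<close>, points are separated neither by \<open>S\<close> (by
  assumption) nor by \<open>K \<union> - ball p r\<close>, which stays away from \<open>p\<close>. These two sets intersect in the
  connected set \<open>K\<close>, so their union does not separate the points either.
\<close>

lemma same_component_near:
  fixes S :: "complex set"
  assumes S: "compact S" "removable_germ S p" and r: "r > 0"
  obtains s where "s > 0" "s \<le> r"
    "\<And>x y. x \<in> ball p s \<Longrightarrow> y \<in> ball p s \<Longrightarrow> connected_component (- S) x y
            \<Longrightarrow> connected_component (ball p r - S) x y"
proof -
  obtain K where K: "closed K" "connected K" "K \<subseteq> S" "p \<notin> K" "S - K \<subseteq> ball p r"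
    using S r unfolding removable_germ_def by blast
  have "open (ball p r - K)" using K by (simp add: open_Diff)
  moreover have "p \<in> ball p r - K" using K r by simp
  ultimately obtain s' where s': "s' > 0" "ball p s' \<subseteq> ball p r - K"
    by (meson open_contains_ball)
  define s where "s = min s' r"
  have s: "s > 0" "s \<le> r" "ball p s \<subseteq> ball p r - K" using s' r by (auto simp: s_def)
  show ?thesis
  proof
    fix x y assume xy: "x \<in> ball p s" "y \<in> ball p s" "connected_component (- S) x y"
    define T where "T = K \<union> - ball p r"
    have "connected_component (- T) x y"
      unfolding connected_component_def using s xy
      by (intro exI[of _ "ball p s"]) (auto simp: T_def)
    moreover have "closed T" unfolding T_def using K(1) by (intro closed_Un closed_Compl open_ball)
    moreover have "S \<inter> T = K" using K unfolding T_def by blast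
    ultimately have "connected_component (- (S \<union> T)) x y"
      using K S xy by (intro Janiszewski) auto
    moreover have "- (S \<union> T) \<subseteq> ball p r - S" by (auto simp: T_def)
    ultimately show "connected_component (ball p r - S) x y"
      by (meson connected_component_of_subset)
  qed (use s in auto)
qed


section \<open>Jordan curves and chords\<close>

text \<open>
  A description by two arcs fits the way in which cycles arise in a network: an arc, closed up by a
  path in the part that was already there.
\<close>

definition jordan_curve :: "complex set \<Rightarrow> bool" where
  "jordan_curve J \<longleftrightarrow>
     (\<exists>A B a b. arc_between A a b \<and> arc_between B a b \<and> A \<inter> B = {a,b} \<and> J = A \<union> B)"

lemma jordan_curve_sides:
  assumes "jordan_curve J"
  shows "open (inside J)" "open (outside J)" "connected (inside J)" "connected (outside J)"
    "inside J \<inter> outside J = {}" "inside J \<union> outside J = - J"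
    "J \<subseteq> closure (inside J)" "J \<subseteq> closure (outside J)"
proof -
  obtain A B a b where J: "arc_between A a b" "arc_between B a b" "A \<inter> B = {a,b}" "J = A \<union> B"
    using assms unfolding jordan_curve_def by blast
  obtain g where g: "arc g" "path_image g = A" "pathstart g = a" "pathfinish g = b"
    using J(1) arc_between_iff_arc by blast
  obtain h where h: "arc h" "path_image h = B" "pathstart h = b" "pathfinish h = a"
    using arc_between_sym[OF J(2)] arc_between_iff_arc by blast
  have "simple_path (g +++ h)"
    using g h J by (intro simple_path_join_loop) auto
  moreover have "pathfinish (g +++ h) = pathstart (g +++ h)" using g h by simp
  moreover have "path_image (g +++ h) = J" using g h J by (simp add: path_image_join)
  ultimately have *: "open (inside J) \<and> connected (inside J) \<and> open (outside J) \<and> connected (outside J) \<and>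
      inside J \<inter> outside J = {} \<and> inside J \<union> outside J = - J \<and>
      frontier (inside J) = J \<and> frontier (outside J) = J"
    using Jordan_inside_outside by metis
  then show "open (inside J)" "open (outside J)" "connected (inside J)" "connected (outside J)"
    "inside J \<inter> outside J = {}" "inside J \<union> outside J = - J"
    by auto
  show "J \<subseteq> closure (inside J)" "J \<subseteq> closure (outside J)"
    using * by (metis Diff_subset frontier_def)+
qed

lemma jordan_curve_compact:
  assumes "jordan_curve J"
  shows "compact J"
proof -
  obtain A B a b where "arc_between A a b" "arc_between B a b" "J = A \<union> B"
    using assms unfolding jordan_curve_def by blast
  then show ?thesis using arc_between_basic(4) by blast
qed

lemma jordan_curve_removable_germ:
  assumes "jordan_curve J" "p \<in> J"
  shows "removable_germ J p"
proof -
  obtain A B a b where J: "arc_between A a b" "arc_between B a b" "A \<inter> B = {a,b}" "J = A \<union> B"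
    using assms unfolding jordan_curve_def by blast
  have conn: "connected A" "closed A" "connected B" "closed B"
    using arc_between_basic(5,7)[OF J(1)] arc_between_basic(5,7)[OF J(2)] by auto
  consider "p = a \<or> p = b" | "p \<in> B" "p \<notin> A" | "p \<in> A" "p \<notin> B"
    using assms J by auto
  then show ?thesis
  proof cases
    case 1
    then have "removable_germ A p" "p \<in> A"
      using removable_germ_arc_end[OF J(1)] removable_germ_arc_end[OF arc_between_sym[OF J(1)]]
        arc_between_basic(1,2)[OF J(1)] by auto
    then show ?thesis
      using removable_germ_add_old[OF _ _ J(2)] J by (simp add: Int_commute)
  next
    case 2
    then show ?thesis
      using removable_germ_add_new[OF conn(1,2) J(2)] J by (simp add: Int_commute)
  next
    case 3
    then show ?thesis
      using removable_germ_add_new[OF conn(3,4) J(1)] J by (simp add: Un_commute)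
  qed
qed

lemma chord_closes_jordan_curve:
  assumes S: "path_connected S" and A: "arc_between A a b" "A \<inter> S = {a,b}"
  obtains J where "jordan_curve J" "A \<subseteq> J" "J \<subseteq> S \<union> A"
proof -
  have "a \<in> S" "b \<in> S" "a \<noteq> b" using A(2) arc_between_basic[OF A(1)] by auto
  then obtain g where g: "arc g" "path_image g \<subseteq> S" "pathstart g = a" "pathfinish g = b"
    using S unfolding path_connected_arcwise by blast
  then have B: "arc_between (path_image g) a b" using arc_between_iff_arc by blast
  have "A \<inter> path_image g = {a,b}"
    using g(2) A arc_between_basic(1,2)[OF B] by auto
  then have "jordan_curve (A \<union> path_image g)"
    using A(1) B unfolding jordan_curve_def by blast
  then show ?thesis using that g(2) by blast
qed

text \<open>
  A Jordan curve through the chord has the two sides of the chord on different sides of itself. So the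
  face \<open>W\<close> of \<open>S\<close> that contains the interior of the chord is replaced by at least two faces, and the other
  faces of \<open>S\<close> survive.
\<close>

lemma chord_splits_face:
  assumes S: "closed S" and A: "arc_between A a b" "A \<inter> S = {a,b}"
    and J: "jordan_curve J" "A \<subseteq> J" "J \<subseteq> S \<union> A"
    and F: "finite F" "F \<subseteq> components (- S)"
  obtains F' where "finite F'" "F' \<subseteq> components (- (S \<union> A))" "card F + 1 \<le> card F'"
proof -
  note sides = jordan_curve_sides[OF J(1)]
  obtain p where p: "p \<in> A - {a,b}" using arc_between_interior(2)[OF A(1)] by blast
  then have "p \<in> - S" "open (- S)" using A S by auto
  then obtain r where r: "r > 0" "ball p r \<subseteq> - S" by (meson open_contains_ball)
  define W where "W = connected_component_set (- S) p"
  have ballW: "ball p r \<subseteq> W"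
    unfolding W_def using r by (intro connected_component_maximal) auto
  have pJ: "p \<in> closure (inside J)" "p \<in> closure (outside J)" using p J sides by auto
  obtain x where x: "x \<in> inside J" "x \<in> ball p r"
    using pJ(1) r(1) unfolding closure_approachable by (auto simp: dist_commute)
  obtain y where y: "y \<in> outside J" "y \<in> ball p r"
    using pJ(2) r(1) unfolding closure_approachable by (auto simp: dist_commute)
  have xy: "x \<in> - (S \<union> A)" "y \<in> - (S \<union> A)"
    using x y r subsetD[OF J(2)] sides(6) by fastforce+
  define U V where "U = connected_component_set (- (S \<union> A)) x"
    and "V = connected_component_set (- (S \<union> A)) y"
  have UV: "U \<in> components (- (S \<union> A))" "V \<in> components (- (S \<union> A))" "x \<in> U" "y \<in> V"
    using xy unfolding U_def V_def components_def by auto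
  have UVW: "U \<subseteq> W" "V \<subseteq> W"
  proof -
    have sub: "connected_component_set (- (S \<union> A)) z \<subseteq> W" if "z \<in> ball p r" for z
    proof -
      have "connected_component_set (- (S \<union> A)) z \<subseteq> connected_component_set (- S) z"
        by (intro connected_component_mono) auto
      also have "\<dots> = W"
        using ballW that unfolding W_def by (meson connected_component_eq subsetD)
      finally show ?thesis .
    qed
    show "U \<subseteq> W" "V \<subseteq> W" unfolding U_def V_def using sub x y by auto
  qed
  have "U \<noteq> V"
  proof
    assume "U = V"
    then have "connected U" "x \<in> U" "y \<in> U" "U \<subseteq> inside J \<union> outside J"
      using UV in_components_connected in_components_subset[OF UV(1)] J(3) sides(6) by auto
    then show False
      using connectedD[of U "inside J" "outside J"] sides x y by blast
  qed
  have AW: "A - {a,b} \<subseteq> W"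
    unfolding W_def using A arc_between_interior(1)[OF A(1)] p
    by (intro connected_component_maximal) auto
  have Wcomp: "W \<in> components (- S)" unfolding W_def components_def using \<open>p \<in> - S\<close> by auto
  have old: "X \<in> components (- (S \<union> A)) \<and> X \<noteq> U \<and> X \<noteq> V" if "X \<in> F - {W}" for X
  proof -
    have X: "X \<in> components (- S)" "X \<noteq> W" using F that by auto
    then have disj: "X \<inter> W = {}"
      using components_nonoverlap[OF _ Wcomp] by simp
    then have "X \<subseteq> - (S \<union> A)"
      using AW A in_components_subset[OF X(1)] by blast
    then have "X \<in> components (- (S \<union> A))"
      by (rule components_intermediate_subset[OF X(1)]) blast
    then show ?thesis using disj UVW UV by blast
  qed
  show ?thesis
  proof
    show "finite ((F - {W}) \<union> {U,V})" "(F - {W}) \<union> {U,V} \<subseteq> components (- (S \<union> A))"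
      using F old UV by auto
    have "card ((F - {W}) \<union> {U,V}) = card (F - {W}) + card {U,V}"
      using F old by (intro card_Un_disjoint) auto
    moreover have "card F \<le> card (F - {W}) + 1"
      using F diff_card_le_card_Diff[of "{W}" F] by simp
    ultimately show "card F + 1 \<le> card ((F - {W}) \<union> {U,V})"
      using \<open>U \<noteq> V\<close> by simp
  qed
qed

section \<open>Plane graphs built from a circle by subdivisions and chords\<close>

text \<open>
  Endpoints of later arcs become vertices by subdivision. Edges are point sets and the ends
  of an edge \<open>e\<close> are the two points of \<open>e \<inter> P\<close>, so that \<open>e - P\<close> is its interior.
\<close>

inductive plane_net :: "complex set set \<Rightarrow> complex set \<Rightarrow> bool" where
  circle: "arc_between A a b \<Longrightarrow> arc_between B a b \<Longrightarrow> A \<inter> B = {a,b} \<Longrightarrow> plane_net {A,B} {a,b}"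
| subdivide: "plane_net EE P \<Longrightarrow> A \<union> B \<in> EE \<Longrightarrow> (A \<union> B) \<inter> P = {a,b} \<Longrightarrow>
    arc_between A a c \<Longrightarrow> arc_between B c b \<Longrightarrow> A \<inter> B = {c} \<Longrightarrow>
    plane_net (insert A (insert B (EE - {A \<union> B}))) (insert c P)"
| chord: "plane_net EE P \<Longrightarrow> arc_between A a b \<Longrightarrow> a \<in> P \<Longrightarrow> b \<in> P \<Longrightarrow> A \<inter> \<Union>EE = {a,b} \<Longrightarrow>
    plane_net (insert A EE) P"

lemma Union_subdivide:
  "A \<union> B \<in> EE \<Longrightarrow> \<Union>(insert A (insert B (EE - {A \<union> B}))) = \<Union>EE"
  by blast

lemma plane_net_edges:
  assumes "plane_net EE P"
  shows "finite EE \<and> finite P \<and> P \<subseteq> \<Union>EE \<and>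
         (\<forall>e\<in>EE. \<exists>a b. arc_between e a b \<and> e \<inter> P = {a,b}) \<and>
         (\<forall>e\<in>EE. \<forall>e'\<in>EE. e \<noteq> e' \<longrightarrow> e \<inter> e' \<subseteq> P)"
  using assms
proof induction
  case (circle A a b B)
  have "\<forall>e\<in>{A,B}. \<exists>x y. arc_between e x y \<and> e \<inter> {a,b} = {x,y}"
    using circle by blast
  moreover have "\<forall>e\<in>{A,B}. \<forall>e'\<in>{A,B}. e \<noteq> e' \<longrightarrow> e \<inter> e' \<subseteq> {a,b}" "{a,b} \<subseteq> \<Union>{A,B}"
    using circle(3) by blast+
  ultimately show ?case by (intro conjI) (assumption | rule finite.intros)+
next
  case (subdivide EE P A B a b c)
  note ab = arc_between_basic(1-3)[OF subdivide(4)] arc_between_basic(1-3)[OF subdivide(5)]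
  have AB: "x = c" if "x \<in> A" "x \<in> B" for x using that subdivide(6) by blast
  then have "a \<notin> B" "b \<notin> A" using ab by metis+
  moreover have "a \<in> P" "b \<in> P" "\<And>x. x \<in> P \<Longrightarrow> x \<in> A \<or> x \<in> B \<Longrightarrow> x = a \<or> x = b"
    using subdivide(3) by blast+
  ultimately have A: "A \<inter> insert c P = {a,c}" and B: "B \<inter> insert c P = {c,b}"
    using ab by blast+
  have other: "x \<inter> A \<subseteq> P" "x \<inter> B \<subseteq> P" "c \<notin> x" if "x \<in> EE" "x \<noteq> A \<union> B" for x
  proof -
    have "x \<inter> (A \<union> B) \<subseteq> P" using subdivide(2,7) that by metis
    moreover have "c \<notin> P" "c \<in> A" using subdivide(3) ab by auto
    ultimately show "x \<inter> A \<subseteq> P" "x \<inter> B \<subseteq> P" "c \<notin> x" by auto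
  qed
  have "x \<inter> insert c P = x \<inter> P" if "x \<in> EE" "x \<noteq> A \<union> B" for x
    using other[OF that] by auto
  then have "\<exists>a b. arc_between x a b \<and> x \<inter> insert c P = {a,b}"
    if "x \<in> insert A (insert B (EE - {A \<union> B}))" for x
    using that A B subdivide(4,5,7) by (metis DiffE insertE singletonI)
  moreover have "x \<inter> y \<subseteq> insert c P"
    if "x \<in> insert A (insert B (EE - {A \<union> B}))" "y \<in> insert A (insert B (EE - {A \<union> B}))" "x \<noteq> y" for x y
  proof -
    have *: "y \<inter> A \<subseteq> insert c P" "A \<inter> y \<subseteq> insert c P" "y \<inter> B \<subseteq> insert c P" "B \<inter> y \<subseteq> insert c P"
      if "y \<in> EE - {A \<union> B}" for y
      using other(1,2)[of y] that by blast+
    have **: "x \<inter> y \<subseteq> insert c P" if "x \<in> EE - {A \<union> B}" "y \<in> EE - {A \<union> B}"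
      using that \<open>x \<noteq> y\<close> subdivide(7) by (metis DiffD1 subset_insertI2)
    have "A \<inter> B \<subseteq> insert c P" "B \<inter> A \<subseteq> insert c P" using subdivide(6) by blast+
    then show ?thesis using that * ** by (metis insertE)
  qed
  moreover have "P \<subseteq> \<Union>EE" "c \<in> \<Union>EE" using subdivide(2,7) ab by auto
  ultimately show ?case
    unfolding Union_subdivide[OF subdivide(2)] using subdivide(7) by simp
next
  case (chord EE P A a b)
  have "P \<subseteq> \<Union>EE" using chord(6) by blast
  then have "A \<inter> P = {a,b}" using chord(3-5) by blast
  then have "\<forall>e\<in>insert A EE. \<exists>a b. arc_between e a b \<and> e \<inter> P = {a,b}"
    using chord(2,6) by (metis insertE)
  moreover have *: "A \<inter> e \<subseteq> P" "e \<inter> A \<subseteq> P" if "e \<in> EE" for e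
  proof -
    have "A \<inter> e \<subseteq> {a,b}" using that chord(5) by blast
    then show "A \<inter> e \<subseteq> P" "e \<inter> A \<subseteq> P" using chord(3,4) by blast+
  qed
  have "x \<inter> y \<subseteq> P" if "x \<in> insert A EE" "y \<in> insert A EE" "x \<noteq> y" for x y
    using that * chord(6) by (metis insertE)
  ultimately show ?case using chord(6) by auto
qed

text \<open>
  This excludes dangling edges: the two sides of such an edge would belong to the same face.
\<close>

lemma plane_net_vertex_degree:
  assumes "plane_net EE P" "v \<in> P"
  shows "\<exists>e\<in>EE. \<exists>e'\<in>EE. e \<noteq> e' \<and> v \<in> e \<and> v \<in> e'"
  using assms
proof induction
  case (circle A a b B)
  have "A \<noteq> B"
    using arc_between_interior(2)[OF circle(1)] circle(3) by (metis Diff_cancel Int_absorb)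
  moreover have "v \<in> A" "v \<in> B" using circle(3,4) by blast+
  ultimately show ?case by blast
next
  case (subdivide EE P A B a b c)
  note ab = arc_between_basic(1-3)[OF subdivide(4)] arc_between_basic(1-3)[OF subdivide(5)]
  have "x = c" if "x \<in> A" "x \<in> B" for x using that subdivide(6) by blast
  then have neq: "A \<noteq> B" using ab by metis
  have "c \<notin> P" using subdivide(3) ab by auto
  have new: "X \<notin> EE - {A \<union> B}" if "c \<in> X" for X
  proof
    assume "X \<in> EE - {A \<union> B}"
    then have "X \<inter> (A \<union> B) \<subseteq> P"
      using plane_net_edges[OF subdivide(1)] subdivide(2) by (metis Diff_iff singletonI)
    then show False using that ab \<open>c \<notin> P\<close> by blast
  qed
  show ?case
  proof (cases "v = c")
    case True then show ?thesis using neq ab by blast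
  next
    case False
    then have "v \<in> P" using subdivide(8) by simp
    then obtain e e' where e: "e \<in> EE" "e' \<in> EE" "e \<noteq> e'" "v \<in> e" "v \<in> e'"
      using subdivide(7) by blast
    have *: "\<exists>x\<in>insert A (insert B (EE - {A \<union> B})). v \<in> x \<and> x \<noteq> e'"
      if "v \<in> e" "e \<in> EE" "e' \<in> EE - {A \<union> B}" "e \<noteq> e'" for e e'
    proof (cases "e = A \<union> B")
      case True
      have "A \<noteq> e'" "B \<noteq> e'" using new[of A] new[of B] ab that(3) by metis+
      then show ?thesis using that(1) True by blast
    qed (use that in blast)
    have "\<exists>x\<in>insert A (insert B (EE - {A \<union> B})). v \<in> x \<and> x \<noteq> y"
      if "v \<in> y" "y \<in> EE - {A \<union> B}" "y \<in> {e,e'}" for y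
      using * e that by (metis insertE singletonD)
    moreover have "e \<in> EE - {A \<union> B} \<or> e' \<in> EE - {A \<union> B}" using e by blast
    ultimately show ?thesis using e(4,5) by (metis insertCI)
  qed
next
  case (chord EE P A a b)
  then have "\<exists>e\<in>EE. \<exists>e'\<in>EE. e \<noteq> e' \<and> v \<in> e \<and> v \<in> e'" by simp
  then show ?case by blast
qed

lemma plane_net_connected:
  assumes "plane_net EE P"
  shows "compact (\<Union>EE) \<and> path_connected (\<Union>EE) \<and> (\<forall>p\<in>\<Union>EE. removable_germ (\<Union>EE) p)"
  using assms
proof induction
  case (circle A a b B)
  then have J: "jordan_curve (A \<union> B)" unfolding jordan_curve_def by blast
  have "path_connected (A \<union> B)"
    using circle(3) arc_between_basic(6)[OF circle(1)] arc_between_basic(6)[OF circle(2)]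
    by (intro path_connected_Un) auto
  then show ?case
    using J jordan_curve_compact jordan_curve_removable_germ by simp
next
  case (subdivide EE P A B a b c)
  show ?case using subdivide(7) unfolding Union_subdivide[OF subdivide(2)] .
next
  case (chord EE P A a b)
  note A = arc_between_basic[OF chord(2)]
  have E: "compact (\<Union>EE)" "path_connected (\<Union>EE)" "\<forall>p\<in>\<Union>EE. removable_germ (\<Union>EE) p"
    using chord by blast+
  have "\<Union>(insert A EE) = \<Union>EE \<union> A" by blast
  moreover have "compact (\<Union>EE \<union> A)" using E A by blast
  moreover have "path_connected (\<Union>EE \<union> A)"
    using chord(5) by (intro path_connected_Un E A) blast
  moreover have "removable_germ (\<Union>EE \<union> A) p" if "p \<in> \<Union>EE \<union> A" for p
  proof (cases "p \<in> \<Union>EE")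
    case True
    then show ?thesis using removable_germ_add_old[OF _ _ chord(2,5)] E by blast
  next
    case False
    then show ?thesis
      using removable_germ_add_new[OF _ _ chord(2,5)] that E
      by (metis UnE compact_imp_closed path_connected_imp_connected)
  qed
  ultimately show ?case by simp
qed

lemma plane_net_edge_in_jordan_curve:
  assumes "plane_net EE P" "e \<in> EE"
  shows "\<exists>J. jordan_curve J \<and> e \<subseteq> J \<and> J \<subseteq> \<Union>EE"
  using assms
proof (induction arbitrary: e)
  case (circle A a b B)
  then have J: "jordan_curve (A \<union> B)" unfolding jordan_curve_def by blast
  show ?case using circle J by (intro exI[of _ "A \<union> B"]) auto
next
  case (subdivide EE P A B a b c)
  then have "\<exists>e'\<in>EE. e \<subseteq> e'" by auto
  then obtain e' where "e' \<in> EE" "e \<subseteq> e'" by blast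
  then show ?case using subdivide(7)[of e'] unfolding Union_subdivide[OF subdivide(2)] by blast
next
  case (chord EE P A a b)
  show ?case
  proof (cases "e = A")
    case True
    obtain J where "jordan_curve J" "A \<subseteq> J" "J \<subseteq> \<Union>EE \<union> A"
      using chord_closes_jordan_curve[OF _ chord(2,5)] plane_net_connected[OF chord(1)] by metis
    then show ?thesis using True by blast
  next
    case False
    then obtain J where "jordan_curve J" "e \<subseteq> J" "J \<subseteq> \<Union>EE" using chord by blast
    then show ?thesis by blast
  qed
qed

text \<open>
  This is the inequality of Euler's formula that matters here: subdividing an edge raises
  the numbers of edges and vertices by one, and a chord adds one edge and at least one face. In the case
  of a circle the second arc is a chord of the first one, whose complement is connected.
\<close>

lemma plane_net_Euler:
  assumes "plane_net EE P"
  shows "\<exists>F. finite F \<and> F \<subseteq> components (- \<Union>EE) \<and> card EE + 2 \<le> card P + card F"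
  using assms
proof induction
  case (circle A a b B)
  have J: "jordan_curve (A \<union> B)" using circle unfolding jordan_curve_def by blast
  obtain g where "arc g" "path_image g = A" using circle(1) arc_between_iff_arc by blast
  then have "connected (- A)" using connected_arc_complement[of g] by auto
  moreover have "- A \<noteq> {}" 
    using arc_between_basic(4)[OF circle(1)] not_compact_UNIV by (metis Compl_empty_eq double_compl)
  ultimately have F: "{- A} \<subseteq> components (- A)"
    using components_eq_sing_iff by blast
  obtain F' where "finite F'" "F' \<subseteq> components (- (A \<union> B))" "card {- A} + 1 \<le> card F'"
    using chord_splits_face[OF arc_between_basic(7)[OF circle(1)] circle(2) _ J _ _ _ F] circle(3)
    by auto
  moreover have "card {A,B} \<le> 2" "card {a,b} = 2"
    using arc_between_basic(3)[OF circle(1)] by (auto simp: card_insert_if)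
  ultimately show ?case by (intro exI[of _ F']) auto
next
  case (subdivide EE P A B a b c)
  note fin = plane_net_edges[OF subdivide(1)]
  have "c \<notin> P"
    using subdivide(3) arc_between_basic[OF subdivide(4)] arc_between_basic[OF subdivide(5)] by auto
  moreover have "card (insert A (insert B (EE - {A \<union> B}))) \<le> card EE + 1"
  proof -
    have "card (insert A (insert B (EE - {A \<union> B}))) \<le> Suc (Suc (card (EE - {A \<union> B})))"
      using fin card_insert_le_m1 by (simp add: card_insert_if)
    moreover have "card (EE - {A \<union> B}) + 1 = card EE"
      using fin subdivide(2) by (metis Suc_eq_plus1 card_Suc_Diff1)
    ultimately show ?thesis by simp
  qed
  moreover obtain F where "finite F \<and> F \<subseteq> components (- \<Union>EE) \<and> card EE + 2 \<le> card P + card F"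
    using subdivide(7) by blast
  ultimately show ?case
    using fin unfolding Union_subdivide[OF subdivide(2)] by (intro exI[of _ F]) simp
next
  case (chord EE P A a b)
  obtain F where F: "finite F" "F \<subseteq> components (- \<Union>EE)" "card EE + 2 \<le> card P + card F"
    using chord by blast
  have E: "closed (\<Union>EE)" "path_connected (\<Union>EE)"
    using plane_net_connected[OF chord(1)] compact_imp_closed by blast+
  obtain J where J: "jordan_curve J" "A \<subseteq> J" "J \<subseteq> \<Union>EE \<union> A"
    using chord_closes_jordan_curve[OF E(2) chord(2,5)] .
  obtain F' where "finite F'" "F' \<subseteq> components (- (\<Union>EE \<union> A))" "card F + 1 \<le> card F'"
    using chord_splits_face[OF E(1) chord(2,5) J F(1,2)] .
  moreover have "\<Union>(insert A EE) = \<Union>EE \<union> A" by blast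
  moreover have "card (insert A EE) \<le> card EE + 1"
    using plane_net_edges[OF chord(1)] by (simp add: card_insert_if)
  ultimately show ?case using F(3) by (intro exI[of _ F']) auto
qed


section \<open>Faces near edges and vertices\<close>

lemma locally_finite_closed:
  fixes p :: "'a::metric_space"
  assumes "finite FF" "\<And>X. X \<in> FF \<Longrightarrow> closed X"
  obtains r where "r > 0" "\<And>X. X \<in> FF \<Longrightarrow> X \<inter> ball p r \<noteq> {} \<Longrightarrow> p \<in> X"
proof -
  have "closed (\<Union>{X \<in> FF. p \<notin> X})" using assms by (intro closed_Union) auto
  moreover have "p \<in> - \<Union>{X \<in> FF. p \<notin> X}" by auto
  ultimately obtain r where "r > 0" "ball p r \<subseteq> - \<Union>{X \<in> FF. p \<notin> X}"
    by (meson open_Compl open_contains_ball)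
  then show ?thesis using that[of r] by blast
qed

lemma plane_net_finite:
  assumes "plane_net EE P"
  shows "finite EE" "finite P" "P \<subseteq> \<Union>EE"
  using plane_net_edges[OF assms] by simp_all

lemma plane_net_closed_edge:
  assumes "plane_net EE P" "e \<in> EE"
  shows "closed e"
  using plane_net_edges[OF assms(1)] assms(2) arc_between_basic(7) by metis

lemma plane_net_edge_arc:
  assumes "plane_net EE P" "e \<in> EE"
  obtains a b where "arc_between e a b" "e \<inter> P = {a,b}" "e - P = e - {a,b}"
proof -
  have "\<exists>a b. arc_between e a b \<and> e \<inter> P = {a,b}"
    using plane_net_edges[OF assms(1)] assms(2) by metis
  then obtain a b where ab: "arc_between e a b" "e \<inter> P = {a,b}" by (elim exE conjE)
  have "e - P = e - e \<inter> P" by blast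
  then have "e - P = e - {a,b}" unfolding ab(2) .
  with ab show ?thesis by (rule that)
qed

lemma plane_net_near_vertex:
  assumes N: "plane_net EE P" and v: "v \<in> P"
  obtains r where "r > 0" "P \<inter> ball v r = {v}" "\<And>e. e \<in> EE \<Longrightarrow> e \<inter> ball v r \<noteq> {} \<Longrightarrow> v \<in> e"
proof -
  have "finite (EE \<union> (\<lambda>x. {x}) ` P)" using plane_net_finite[OF N] by simp
  then obtain r where r: "r > 0"
    "\<And>X. X \<in> EE \<union> (\<lambda>x. {x}) ` P \<Longrightarrow> X \<inter> ball v r \<noteq> {} \<Longrightarrow> v \<in> X"
    using locally_finite_closed[of "EE \<union> (\<lambda>x. {x}) ` P" v] plane_net_closed_edge[OF N] by blast
  have "x = v" if "x \<in> P" "x \<in> ball v r" for x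
    using r(2)[of "{x}"] that by auto
  then have "P \<inter> ball v r = {v}" using v r(1) by auto
  then show ?thesis using that[of r] r by blast
qed

lemma plane_net_unique_edge:
  assumes "plane_net EE P" "e \<in> EE" "e' \<in> EE" "x \<in> e" "x \<in> e'" "x \<notin> P"
  shows "e = e'"
  using plane_net_edges[OF assms(1)] assms(2-) by (metis IntI subsetD)

lemma plane_net_near_edge:
  assumes N: "plane_net EE P" and p: "e \<in> EE" "p \<in> e - P"
  obtains r where "r > 0" "\<Union>EE \<inter> ball p r \<subseteq> e - P"
proof -
  have fin: "finite EE" "closed P" using plane_net_finite[OF N] finite_imp_closed by simp_all
  have "finite (insert P EE)" using fin by simp
  then obtain r where r: "r > 0" "\<And>X. X \<in> insert P EE \<Longrightarrow> X \<inter> ball p r \<noteq> {} \<Longrightarrow> p \<in> X"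
    using locally_finite_closed[of "insert P EE" p] fin plane_net_closed_edge[OF N] by blast
  have "x \<in> e - P" if "x \<in> e'" "e' \<in> EE" "x \<in> ball p r" for x e'
  proof -
    have "p \<in> e'" using r(2)[of e'] that by blast
    then have "e' = e" using plane_net_unique_edge[OF N] that p by blast
    moreover have "x \<notin> P" using r(2)[of P] that p by blast
    ultimately show ?thesis using that by simp
  qed
  then show ?thesis using that[of r] r by blast
qed

text \<open>
  Near an interior point of an edge the net coincides with a Jordan curve \<open>J\<close>. Inside and outside of \<open>J\<close>
  have one branch each at that point and come arbitrarily close to every point of \<open>J\<close>.
\<close>

lemma edge_point_faces:
  assumes N: "plane_net EE P" and p: "e \<in> EE" "p \<in> e - P"
  obtains s U V where "s > 0" "U \<in> components (- \<Union>EE)" "V \<in> components (- \<Union>EE)"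
    "ball p s - \<Union>EE \<subseteq> U \<union> V" "\<Union>EE \<inter> ball p s \<subseteq> closure U \<inter> closure V"
proof -
  obtain r where r: "r > 0" "\<Union>EE \<inter> ball p r \<subseteq> e - P"
    using plane_net_near_edge[OF N p] .
  obtain J where J: "jordan_curve J" "e \<subseteq> J" "J \<subseteq> \<Union>EE"
    using plane_net_edge_in_jordan_curve[OF N p(1)] by blast
  note sides = jordan_curve_sides[OF J(1)]
  have pJ: "p \<in> J" using p J by blast
  obtain s where s: "s > 0" "s \<le> r"
    and conn: "\<And>x y. x \<in> ball p s \<Longrightarrow> y \<in> ball p s \<Longrightarrow> connected_component (- J) x y
            \<Longrightarrow> connected_component (ball p r - J) x y"
    using same_component_near[OF jordan_curve_compact[OF J(1)] jordan_curve_removable_germ[OF J(1) pJ] r(1)]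
    by blast
  have EJ: "\<Union>EE \<inter> ball p s \<subseteq> J" using r(2) J(2) s(2) by fastforce
  have side: "\<exists>U. U \<in> components (- \<Union>EE) \<and> D \<inter> ball p s \<subseteq> U \<and> \<Union>EE \<inter> ball p s \<subseteq> closure U"
    if D: "connected D" "D \<subseteq> - J" "J \<subseteq> closure D" for D
  proof -
    obtain x where x: "x \<in> D" "x \<in> ball p s"
      using pJ D(3) s(1) unfolding closure_approachable by (metis closure_approachable dist_commute mem_ball subsetD)
    define U where "U = connected_component_set (- \<Union>EE) x"
    have "x \<in> - \<Union>EE" using x D(2) EJ by blast
    then have comp: "U \<in> components (- \<Union>EE)" unfolding U_def components_def by blast
    have sub: "D \<inter> ball p s \<subseteq> U"
    proof
      fix y assume y: "y \<in> D \<inter> ball p s"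
      then have "connected_component (- J) x y"
        using D x unfolding connected_component_def by blast
      then have "connected_component (ball p r - J) x y" using conn x y by blast
      moreover have "ball p r - J \<subseteq> - \<Union>EE" using r(2) J(2) by blast
      ultimately show "y \<in> U" unfolding U_def by (simp add: connected_component_of_subset)
    qed
    have "\<Union>EE \<inter> ball p s \<subseteq> ball p s \<inter> closure D" using EJ D(3) by blast
    also have "\<dots> \<subseteq> closure (ball p s \<inter> D)" by (simp add: open_Int_closure_subset)
    also have "\<dots> \<subseteq> closure U" using sub by (intro closure_mono) blast
    finally show ?thesis using comp sub by blast
  qed
  obtain U where U: "U \<in> components (- \<Union>EE)" "inside J \<inter> ball p s \<subseteq> U" "\<Union>EE \<inter> ball p s \<subseteq> closure U"
    using side[of "inside J"] sides by blast
  obtain V where V: "V \<in> components (- \<Union>EE)" "outside J \<inter> ball p s \<subseteq> V" "\<Union>EE \<inter> ball p s \<subseteq> closure V"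
    using side[of "outside J"] sides by blast
  have "ball p s - \<Union>EE \<subseteq> U \<union> V" using U(2) V(2) J(3) sides(6) by blast
  then show ?thesis using that s(1) U V by blast
qed

lemma face_meeting_ball:
  assumes "U \<in> components (- E)" "p \<in> closure U" "s > 0"
    and "V \<in> components (- E)" "W \<in> components (- E)" "ball p s - E \<subseteq> V \<union> W"
  shows "U = V \<or> U = W"
proof -
  obtain x where x: "x \<in> U" "x \<in> ball p s"
    using assms(2,3) unfolding closure_approachable by (metis dist_commute mem_ball)
  then have "x \<in> V \<union> W" using assms(6) in_components_subset[OF assms(1)] by blast
  then show ?thesis
    using x(1) components_eq[OF assms(1,4)] components_eq[OF assms(1,5)] by blast
qed

lemma edge_point_two_faces:
  assumes N: "plane_net EE P" and p: "e \<in> EE" "p \<in> e - P"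
    and U: "U \<in> components (- \<Union>EE)" "p \<in> closure U"
    and V: "V \<in> components (- \<Union>EE)" "p \<in> closure V" and neq: "U \<noteq> V"
  obtains s where "s > 0" "ball p s - \<Union>EE \<subseteq> U \<union> V" "\<Union>EE \<inter> ball p s \<subseteq> closure U \<inter> closure V"
proof -
  obtain s U' V' where s: "s > 0" "U' \<in> components (- \<Union>EE)" "V' \<in> components (- \<Union>EE)"
    "ball p s - \<Union>EE \<subseteq> U' \<union> V'" "\<Union>EE \<inter> ball p s \<subseteq> closure U' \<inter> closure V'"
    using edge_point_faces[OF N p] .
  have "U = U' \<or> U = V'" "V = U' \<or> V = V'"
    using face_meeting_ball[OF U s(1-4)] face_meeting_ball[OF V s(1-4)] by simp_all
  then have "U' \<union> V' = U \<union> V" "closure U' \<inter> closure V' = closure U \<inter> closure V"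
    using neq by (elim disjE; simp add: Un_commute Int_commute)+
  then show ?thesis using s(4,5) by (intro that[OF s(1)]) simp_all
qed

text \<open>
  The set of faces that touch an edge is locally constant along the interior of the edge, which is
  connected.
\<close>

lemma face_borders_whole_edge:
  assumes N: "plane_net EE P" and e: "e \<in> EE" and U: "U \<in> components (- \<Union>EE)"
    and q: "q \<in> e - P" "q \<in> closure U"
  shows "e - P \<subseteq> closure U"
proof -
  obtain a b where ab: "arc_between e a b" "e \<inter> P = {a,b}" "e - P = e - {a,b}"
    using plane_net_edge_arc[OF N e] .
  have conn: "connected (e - P)" unfolding ab(3) using arc_between_interior(1)[OF ab(1)] by simp
  define T where "T = closure U \<inter> (e - P)"
  have "closedin (top_of_set (e - P)) T" unfolding T_def using closedin_closed_Int[OF closed_closure, of "e - P" U] by (simp only: Int_commute)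
  moreover have "openin (top_of_set (e - P)) T"
    unfolding openin_contains_ball
  proof (intro conjI ballI)
    show "T \<subseteq> e - P" by (auto simp: T_def)
    fix x assume x: "x \<in> T"
    then have xe: "x \<in> e - P" "x \<in> closure U" by (auto simp: T_def)
    obtain s V W where s: "s > 0" "V \<in> components (- \<Union>EE)" "W \<in> components (- \<Union>EE)"
      "ball x s - \<Union>EE \<subseteq> V \<union> W" "\<Union>EE \<inter> ball x s \<subseteq> closure V \<inter> closure W"
      using edge_point_faces[OF N e xe(1)] .
    have "U = V \<or> U = W" using face_meeting_ball[OF U xe(2) s(1-4)] .
    then have "ball x s \<inter> (e - P) \<subseteq> T" using s(5) e unfolding T_def by blast
    then show "\<exists>d>0. ball x d \<inter> (e - P) \<subseteq> T" using s(1) by blast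
  qed
  ultimately have "T = {} \<or> T = e - P" using conn unfolding connected_clopen by blast
  then show ?thesis using q unfolding T_def by blast
qed

text \<open>
  The edge \<open>e\<close> alone does not separate the points near its end \<open>v\<close>. A connected set that joins, within
  a small ball and off \<open>e\<close>, a point of \<open>U\<close> to a point of another edge at \<open>v\<close> has to leave \<open>U\<close>. It does
  so at an interior point of an edge at \<open>v\<close> different from \<open>e\<close>.
\<close>

lemma face_borders_another_edge:
  assumes N: "plane_net EE P" and v: "v \<in> P"
    and U: "U \<in> components (- \<Union>EE)" "v \<in> closure U"
    and e: "e \<in> EE" "v \<in> e"
  shows "\<exists>e'\<in>EE. e' \<noteq> e \<and> v \<in> e' \<and> e' - P \<subseteq> closure U"
proof -
  obtain a b where ab: "arc_between e a b" "e \<inter> P = {a,b}" "e - P = e - {a,b}"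
    using plane_net_edge_arc[OF N e(1)] .
  have "v = a \<or> v = b" using v e(2) ab(2) by blast
  then have germ: "removable_germ e v"
    using removable_germ_arc_end[OF ab(1)] removable_germ_arc_end[OF arc_between_sym[OF ab(1)]] by blast
  obtain g where "arc g" "path_image g = e" using ab(1) arc_between_iff_arc by blast
  then have "connected (- e)" using connected_arc_complement[of g] by auto
  obtain r where r: "r > 0" "P \<inter> ball v r = {v}" "\<And>e. e \<in> EE \<Longrightarrow> e \<inter> ball v r \<noteq> {} \<Longrightarrow> v \<in> e"
    using plane_net_near_vertex[OF N v] by metis
  obtain s where s: "s > 0" "s \<le> r"
    and conn: "\<And>x y. x \<in> ball v s \<Longrightarrow> y \<in> ball v s \<Longrightarrow> connected_component (- e) x y
            \<Longrightarrow> connected_component (ball v r - e) x y"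
    using same_component_near[OF arc_between_basic(4)[OF ab(1)] germ r(1)] by blast
  obtain e' where e': "e' \<in> EE" "e' \<noteq> e" "v \<in> e'"
    using plane_net_vertex_degree[OF N v] by metis
  obtain x where x: "x \<in> U" "x \<in> ball v s"
    using U(2) s(1) unfolding closure_approachable by (metis dist_commute mem_ball)
  obtain c d where cd: "arc_between e' c d" "e' \<inter> P = {c,d}" "e' - P = e' - {c,d}"
    using plane_net_edge_arc[OF N e'(1)] .
  have "v = c \<or> v = d" using cd(2) v e'(3) by blast
  then have "v \<in> closure (e' - {c,d})"
    using arc_between_interior(3)[OF cd(1)] arc_between_interior(3)[OF arc_between_sym[OF cd(1)]]
    by (auto simp: insert_commute)
  then obtain y where y: "y \<in> e' - {c,d}" "y \<in> ball v s"
    using s(1) unfolding closure_approachable by (metis dist_commute mem_ball)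
  have yP: "y \<notin> P" "y \<in> e'" using y(1) cd(3) by blast+
  then have "y \<notin> e" using plane_net_unique_edge[OF N] e e' by blast
  moreover have "x \<notin> e" using x(1) in_components_subset[OF U(1)] e(1) by blast
  ultimately have "connected_component (- e) x y"
    using \<open>connected (- e)\<close> unfolding connected_component_def by blast
  then have "connected_component (ball v r - e) x y" using conn x y by blast
  then obtain C where C: "connected C" "C \<subseteq> ball v r - e" "x \<in> C" "y \<in> C"
    unfolding connected_component_def by blast
  have "y \<notin> U" using yP(2) e'(1) in_components_subset[OF U(1)] by blast
  then have "C \<inter> frontier U \<noteq> {}"
    using C x by (intro connected_Int_frontier) auto
  then obtain z where z: "z \<in> C" "z \<in> frontier U" by blast
  have "closed (\<Union>EE)" using plane_net_connected[OF N] compact_imp_closed by blast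
  then have "frontier U \<subseteq> \<Union>EE" using frontier_of_components_closed_complement U(1) by blast
  then obtain e'' where e'': "e'' \<in> EE" "z \<in> e''" using z(2) by blast
  have zb: "z \<in> ball v r" "z \<notin> e" using z C(2) by blast+
  then have "v \<in> e''" using r(3)[OF e''(1)] e''(2) by blast
  have "z \<notin> P" using r(2) zb e(2) by (metis IntI singletonD)
  then have "e'' - P \<subseteq> closure U"
    using face_borders_whole_edge[OF N e''(1) U(1), of z] e''(2) z(2) unfolding frontier_def by blast
  then show ?thesis using e'' zb(2) \<open>v \<in> e''\<close> by blast
qed

lemma face_borders_two_edges:
  assumes N: "plane_net EE P" and v: "v \<in> P"
    and U: "U \<in> components (- \<Union>EE)" "v \<in> closure U"
  shows "2 \<le> card {e \<in> EE. v \<in> e \<and> e - P \<subseteq> closure U}"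
proof -
  obtain e0 where e0: "e0 \<in> EE" "v \<in> e0" using plane_net_finite(3)[OF N] v by blast
  obtain e1 where e1: "e1 \<in> EE" "v \<in> e1" "e1 - P \<subseteq> closure U"
    using face_borders_another_edge[OF N v U e0] by blast
  obtain e2 where e2: "e2 \<in> EE" "e2 \<noteq> e1" "v \<in> e2" "e2 - P \<subseteq> closure U"
    using face_borders_another_edge[OF N v U e1(1,2)] by blast
  have "finite {e \<in> EE. v \<in> e \<and> e - P \<subseteq> closure U}" using plane_net_finite(1)[OF N] by simp
  then have "card {e1,e2} \<le> card {e \<in> EE. v \<in> e \<and> e - P \<subseteq> closure U}"
    using e1 e2 by (intro card_mono) auto
  then show ?thesis using e2(2) by simp
qed

lemma plane_net_nonempty:
  assumes "plane_net EE P"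
  shows "P \<noteq> {}"
  using assms by induction auto

lemma plane_net_finite_faces:
  assumes N: "plane_net EE P"
  shows "finite (components (- \<Union>EE))"
proof -
  have E: "closed (\<Union>EE)" using plane_net_connected[OF N] compact_imp_closed by blast
  have "\<Union>EE \<noteq> {}" using plane_net_nonempty[OF N] plane_net_finite(3)[OF N] by blast
  have borders: "\<exists>e\<in>EE. e - P \<subseteq> closure U" if U: "U \<in> components (- \<Union>EE)" for U
  proof -
    have "U \<noteq> {}" "U \<noteq> UNIV"
      using in_components_nonempty[OF U] in_components_subset[OF U] \<open>\<Union>EE \<noteq> {}\<close> by blast+
    then have "frontier U \<noteq> {}" by (rule frontier_not_empty)
    moreover have "frontier U \<subseteq> \<Union>EE" using frontier_of_components_closed_complement E U by blast
    ultimately obtain z e where z: "z \<in> closure U" "z \<in> e" "e \<in> EE" unfolding frontier_def by blast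
    show ?thesis
    proof (cases "z \<in> P")
      case True
      then show ?thesis using face_borders_another_edge[OF N True U z(1,3,2)] by blast
    next
      case False
      then show ?thesis using face_borders_whole_edge[OF N z(3) U _ z(1)] z(2,3) by blast
    qed
  qed
  have fin: "finite {U \<in> components (- \<Union>EE). e - P \<subseteq> closure U}" if e: "e \<in> EE" for e
  proof -
    obtain a b where ab: "arc_between e a b" "e \<inter> P = {a,b}" "e - P = e - {a,b}"
      using plane_net_edge_arc[OF N e] .
    obtain p where p: "p \<in> e - P" using arc_between_interior(2)[OF ab(1)] ab(3) by blast
    obtain s V W where s: "s > 0" "V \<in> components (- \<Union>EE)" "W \<in> components (- \<Union>EE)"
      "ball p s - \<Union>EE \<subseteq> V \<union> W"
      using edge_point_faces[OF N e p] by metis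
    have "{U \<in> components (- \<Union>EE). e - P \<subseteq> closure U} \<subseteq> {V,W}"
      using face_meeting_ball[OF _ _ s] p by blast
    then show ?thesis by (rule finite_subset) simp
  qed
  have "finite (\<Union>e\<in>EE. {U \<in> components (- \<Union>EE). e - P \<subseteq> closure U})"
    using fin plane_net_finite(1)[OF N] by simp
  then show ?thesis by (rule finite_subset[rotated]) (use borders in blast)
qed


section \<open>Two-colourings of sparse systems of links\<close>

text \<open>
  Every relation merges at most two classes, so that it lowers the number of classes by at most one.
\<close>

lemma quotient_by_few_relations:
  assumes "finite R" "finite N"
  shows "\<exists>h::'a \<Rightarrow> 'a. (\<forall>(x,y)\<in>R. h x = h y) \<and> card N \<le> card (h ` N) + card R"
  using assms(1)
proof induction
  case empty
  show ?case by (intro exI[of _ id]) simp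
next
  case (insert xy R)
  obtain x y where xy: "xy = (x,y)" by force
  obtain h :: "'a \<Rightarrow> 'a" where h: "\<forall>(x,y)\<in>R. h x = h y" "card N \<le> card (h ` N) + card R"
    using insert.IH by blast
  define g where "g = (\<lambda>z. if h z = h x then h y else h z)"
  have "h ` N - {h x} \<subseteq> g ` N" by (auto simp: g_def image_iff)
  then have "card (h ` N - {h x}) \<le> card (g ` N)" using assms(2) by (intro card_mono) auto
  moreover have "card (h ` N) \<le> card (h ` N - {h x}) + 1"
    using diff_card_le_card_Diff[of "{h x}" "h ` N"] by simp
  moreover have "\<forall>(u,v)\<in>insert xy R. g u = g v"
    using h(1) by (auto simp: g_def xy)
  ultimately show ?case using h(2) insert.hyps by (intro exI[of _ g]) simp
qed

lemma two_colouring: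
  assumes "finite R" "finite N" "card R + 2 \<le> card N"
  obtains h :: "'a \<Rightarrow> bool" where "\<And>x y. (x,y) \<in> R \<Longrightarrow> h x = h y" "\<exists>x\<in>N. h x" "\<exists>x\<in>N. \<not> h x"
proof -
  obtain g :: "'a \<Rightarrow> 'a" where g: "\<forall>(x,y)\<in>R. g x = g y" "card N \<le> card (g ` N) + card R"
    using quotient_by_few_relations[OF assms(1,2)] by blast
  then have "2 \<le> card (g ` N)" using assms(3) by simp
  then have "\<not> card (g ` N) \<le> 1" by simp
  then obtain x y where xy: "x \<in> N" "y \<in> N" "g y \<noteq> g x"
    using card_le_Suc0_iff_eq[of "g ` N"] assms(2) by auto
  show ?thesis
  proof (rule that[of "\<lambda>z. g z = g x"])
    show "(g u = g x) = (g v = g x)" if "(u,v) \<in> R" for u v using g(1) that by auto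
  qed (use xy in blast)+
qed

section \<open>Real functions with a closed graph\<close>

lemma closed_vimage_compact:
  fixes f :: "'a::metric_space \<Rightarrow> 'b::metric_space"
  assumes G: "closed (graph_of f)" and K: "compact K"
  shows "closed (f -` K)"
  unfolding closed_sequential_limits
proof (intro allI impI, elim conjE)
  fix x l assume x: "\<forall>n. x n \<in> f -` K" "x \<longlonglongrightarrow> l"
  then have "\<forall>n. f (x n) \<in> K" by simp
  then obtain k r where kr: "k \<in> K" "strict_mono r" "((\<lambda>n. f (x n)) \<circ> r) \<longlonglongrightarrow> k"
    using K unfolding compact_def by meson
  have "(x \<circ> r) \<longlonglongrightarrow> l" using x(2) kr(2) by (rule LIMSEQ_subseq_LIMSEQ)
  then have "(\<lambda>n. (x (r n), f (x (r n)))) \<longlonglongrightarrow> (l, k)"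
    using kr(3) by (intro tendsto_Pair) (simp_all add: o_def)
  moreover have "(x (r n), f (x (r n))) \<in> graph_of f" for n by (simp add: graph_of_def)
  ultimately have "(l, k) \<in> graph_of f"
    using closed_sequentially[OF G, of "\<lambda>n. (x (r n), f (x (r n)))"] by blast
  then show "l \<in> f -` K" using kr(1) by (simp add: graph_of_def)
qed

text \<open>
  Here \<open>c\<close> need not be locally constant on the domain: it may jump between points at which the
  values of \<open>f\<close> are far apart.
\<close>

lemma not_connected_graph_of:
  fixes f :: "'a::metric_space \<Rightarrow> 'b::metric_space" and c :: "'a \<Rightarrow> bool"
  assumes loc: "\<And>p. \<exists>r>0. \<forall>x\<in>ball p r. dist (f x) (f p) < 1 \<longrightarrow> c x = c p"
    and c: "c x" "\<not> c y"
  shows "\<not> connected (graph_of f)"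
proof
  assume conn: "connected (graph_of f)"
  have "(c \<circ> fst) (x, f x) = (c \<circ> fst) (y, f y)"
  proof (rule connected_local_const[OF conn])
    show "(x, f x) \<in> graph_of f" "(y, f y) \<in> graph_of f" by (auto simp: graph_of_def)
    show "\<forall>z\<in>graph_of f. eventually (\<lambda>w. (c \<circ> fst) z = (c \<circ> fst) w) (at z within graph_of f)"
    proof
      fix z assume "z \<in> graph_of f"
      then obtain p where p: "z = (p, f p)" by (auto simp: graph_of_def)
      obtain r where r: "r > 0" "\<forall>x\<in>ball p r. dist (f x) (f p) < 1 \<longrightarrow> c x = c p"
        using loc by blast
      have "c p = c (fst w)" if w: "w \<in> graph_of f" "dist w z < min r 1" for w
      proof -
        obtain q where q: "w = (q, f q)" using w(1) by (auto simp: graph_of_def)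
        have "dist q p < min r 1" "dist (f q) (f p) < min r 1"
          using w(2) dist_fst_le[of w z] dist_snd_le[of w z] by (auto simp: p q)
        then show ?thesis using r(2) by (simp add: q dist_commute)
      qed
      then show "eventually (\<lambda>w. (c \<circ> fst) z = (c \<circ> fst) w) (at z within graph_of f)"
        using r(1) unfolding eventually_at by (intro exI[of _ "min r 1"]) (simp add: p)
    qed
  qed
  then show False using c by simp
qed

section \<open>Behaviour of the function along the faces\<close>

locale closed_graph_net =
  fixes f :: "complex \<Rightarrow> real" and EE :: "complex set set" and P :: "complex set"
  assumes nonneg: "f x \<ge> 0"
    and closed_graph: "closed (graph_of f)"
    and net: "plane_net EE P"
    and disc: "discontinuities f = \<Union>EE"
begin

abbreviation faces :: "complex set set" where
  "faces \<equiv> components (- \<Union>EE)"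

text \<open>
  By closedness of the graph, a face that is tame at \<open>p\<close> has \<open>f p\<close> as the limit of \<open>f\<close> along it.
\<close>

definition tame :: "complex set \<Rightarrow> complex \<Rightarrow> bool" where
  "tame U p \<longleftrightarrow> p \<in> closure U \<and> (\<exists>r>0. \<exists>M. \<forall>x\<in>U \<inter> ball p r. f x \<le> M)"

lemma isCont_if_locally_bounded:
  assumes "r > 0" "\<And>x. x \<in> ball p r \<Longrightarrow> f x \<le> M"
  shows "isCont f p"
  unfolding continuous_at_open
proof (intro allI impI, elim conjE)
  fix V assume V: "open V" "f p \<in> V"
  have "compact ({0..M} - V)" using V(1) by (intro compact_diff) auto
  then have "open (ball p r - f -` ({0..M} - V))"
    using closed_vimage_compact[OF closed_graph] by (intro open_Diff) auto
  moreover have "p \<in> ball p r - f -` ({0..M} - V)" using V assms(1) by simp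
  moreover have "\<forall>x\<in>ball p r - f -` ({0..M} - V). f x \<in> V" using assms(2) nonneg by auto
  ultimately show "\<exists>S. open S \<and> p \<in> S \<and> (\<forall>x\<in>S. f x \<in> V)" by blast
qed

lemma bound_passes_to_closure:
  assumes "q \<in> closure U" "q \<in> ball p r" "\<And>x. x \<in> U \<inter> ball p r \<Longrightarrow> a \<le> f x \<and> f x \<le> b"
  shows "a \<le> f q \<and> f q \<le> b"
proof -
  have "q \<in> ball p r \<inter> closure U" using assms by simp
  also have "\<dots> \<subseteq> closure (ball p r \<inter> U)" by (simp add: open_Int_closure_subset)
  also have "\<dots> \<subseteq> f -` {a..b}"
    using closed_vimage_compact[OF closed_graph, of "{a..b}"] assms(3)
    by (intro closure_minimal) auto
  finally show ?thesis by simp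
qed

lemma tame_nearby:
  assumes "tame U p"
  obtains r M where "r > 0" "\<And>q. q \<in> ball p r \<Longrightarrow> q \<in> closure U \<Longrightarrow> tame U q \<and> f q \<le> M"
proof -
  obtain r M where r: "r > 0" "\<And>x. x \<in> U \<inter> ball p r \<Longrightarrow> f x \<le> M"
    using assms unfolding tame_def by blast
  show ?thesis
  proof
    fix q assume q: "q \<in> ball p r" "q \<in> closure U"
    then obtain d where d: "d > 0" "ball q d \<subseteq> ball p r" by (meson open_ball open_contains_ball)
    then have "\<forall>x\<in>U \<inter> ball q d. f x \<le> M" using r(2) by blast
    then have "tame U q" using q(2) d(1) unfolding tame_def by blast
    moreover have "0 \<le> f q \<and> f q \<le> M"
      using bound_passes_to_closure[OF q(2,1)] r(2) nonneg by blast
    ultimately show "tame U q \<and> f q \<le> M" by simp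
  qed (rule r(1))
qed

lemma tame_approximates:
  assumes "tame U q" "s > 0" "f q < c"
  obtains z where "z \<in> U" "z \<in> ball q s" "f z < c"
proof -
  obtain r M where r: "r > 0" "\<And>x. x \<in> U \<inter> ball q r \<Longrightarrow> f x \<le> M" and q: "q \<in> closure U"
    using assms(1) unfolding tame_def by blast
  have "\<exists>z\<in>U. z \<in> ball q s \<and> f z < c"
  proof (rule ccontr)
    assume "\<not> ?thesis"
    then have "c \<le> f x \<and> f x \<le> M" if "x \<in> U \<inter> ball q (min r s)" for x
      using that r(2) by fastforce
    then have "c \<le> f q \<and> f q \<le> M"
      using r(1) assms(2) by (intro bound_passes_to_closure[OF q, of q "min r s"]) auto
    then show False using assms(3) by simp
  qed
  then show ?thesis using that by blast
qed

text \<open>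
  Let \<open>m\<close> be a large value different from \<open>f p\<close>. As the graph is closed, \<open>f\<close> avoids \<open>m\<close> near \<open>p\<close>. Points of
  \<open>U\<close> near \<open>p\<close> are joined by connected sets in \<open>U\<close> near \<open>p\<close>, where \<open>f\<close> is continuous, so either all of
  their values lie below \<open>m\<close> or all of them lie above.
\<close>

lemma blow_up_if_not_tame:
  assumes U: "U \<in> faces" and p: "p \<in> \<Union>EE" "p \<in> closure U" "\<not> tame U p"
  obtains s where "s > 0" "\<And>x. x \<in> U \<inter> ball p s \<Longrightarrow> M < f x"
proof -
  define m where "m = max M (f p) + 1"
  have "closed (f -` {m})" by (rule closed_vimage_compact[OF closed_graph]) simp
  then have "open (- (f -` {m}))" by (rule open_Compl)
  moreover have "f p \<noteq> m" by (simp add: m_def max_def)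
  then have "p \<in> - (f -` {m})" by simp
  ultimately obtain r where r: "r > 0" "ball p r \<subseteq> - (f -` {m})"
    by (rule openE)
  have E: "compact (\<Union>EE)" "removable_germ (\<Union>EE) p"
    using plane_net_connected[OF net] bspec[OF _ p(1)] by metis+
  obtain s where s: "s > 0" and
    conn: "\<And>x y. x \<in> ball p s \<Longrightarrow> y \<in> ball p s \<Longrightarrow> connected_component (- \<Union>EE) x y
            \<Longrightarrow> connected_component (ball p r - \<Union>EE) x y"
    using same_component_near[OF E r(1)] by metis
  have large: "m < f y" if y: "y \<in> U \<inter> ball p s" and x: "x \<in> U \<inter> ball p s" "m < f x" for x y
  proof (rule ccontr)
    assume "\<not> m < f y"
    have "connected_component (- \<Union>EE) x y"
      using U x(1) y in_components_connected in_components_subset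
      unfolding connected_component_def by (metis IntD1)
    then have "connected_component (ball p r - \<Union>EE) x y" using conn x y by blast
    then obtain C where C: "connected C" "C \<subseteq> ball p r - \<Union>EE" "x \<in> C" "y \<in> C"
      unfolding connected_component_def by blast
    have "isCont f z" if "z \<in> C" for z
    proof -
      have "z \<notin> discontinuities f" using that C(2) disc by blast
      then show ?thesis by (simp add: discontinuities_def)
    qed
    then have "continuous_on C f" by (intro continuous_at_imp_continuous_on) simp
    then have "connected (f ` C)" using C(1) connected_continuous_image by blast
    moreover have "f y \<in> f ` C" "f x \<in> f ` C" "f y \<le> m" "m \<le> f x"
      using C(3,4) x(2) \<open>\<not> m < f y\<close> by auto
    ultimately have "m \<in> f ` C" unfolding connected_iff_interval by blast
    then show False using r(2) C(2) by blast
  qed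
  have "\<exists>x\<in>U \<inter> ball p s. m < f x"
    using p(2,3) s unfolding tame_def by (meson not_le)
  then have "M < f y" if "y \<in> U \<inter> ball p s" for y
    using large[OF that] unfolding m_def by fastforce
  then show ?thesis using that[OF s] by blast
qed

lemma finite_faces: "finite faces"
  by (rule plane_net_finite_faces[OF net])

text \<open>
  If \<open>U\<close> and \<open>V\<close> were different, they would fill a neighbourhood of \<open>p\<close> up to points in the closures of
  both of them. Thus \<open>f\<close> would be bounded near \<open>p\<close> and, having a closed graph, continuous at \<open>p\<close>.
\<close>

lemma unique_tame_face:
  assumes e: "e \<in> EE" "p \<in> e - P" and UV: "U \<in> faces" "V \<in> faces" "tame U p" "tame V p"
  shows "U = V"
proof (rule ccontr)
  assume "U \<noteq> V"
  have cl: "p \<in> closure U" "p \<in> closure V" using UV unfolding tame_def by blast+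
  obtain s where s: "s > 0" "ball p s - \<Union>EE \<subseteq> U \<union> V" "\<Union>EE \<inter> ball p s \<subseteq> closure U \<inter> closure V"
    by (rule edge_point_two_faces[OF net e UV(1) cl(1) UV(2) cl(2) \<open>U \<noteq> V\<close>])
  obtain r M where r: "r > 0" "\<And>q. q \<in> ball p r \<Longrightarrow> q \<in> closure U \<Longrightarrow> tame U q \<and> f q \<le> M"
    using tame_nearby[OF UV(3)] by metis
  obtain r' M' where r': "r' > 0" "\<And>q. q \<in> ball p r' \<Longrightarrow> q \<in> closure V \<Longrightarrow> tame V q \<and> f q \<le> M'"
    using tame_nearby[OF UV(4)] by metis
  have "f x \<le> max M M'" if x: "x \<in> ball p (min s (min r r'))" for x
  proof -
    have "x \<in> ball p s" "x \<in> ball p r" "x \<in> ball p r'" using x by auto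
    moreover from this have "x \<in> closure U \<or> x \<in> closure V"
      using s(2,3) closure_subset by blast
    ultimately show ?thesis using r(2)[of x] r'(2)[of x] by fastforce
  qed
  then have "isCont f p" using s(1) r(1) r'(1)
    by (intro isCont_if_locally_bounded[of "min s (min r r')"]) auto
  moreover have "p \<in> discontinuities f" using e disc by blast
  ultimately show False by (simp add: discontinuities_def)
qed

text \<open>
  Of the pieces of the graph over the faces, only those of faces that are tame at \<open>p\<close> come near
  \<open>(p, f p)\<close>, because \<open>f\<close> exceeds \<open>f p + 1\<close> along the others. There are finitely many faces, so that one radius serves all of
  them.
\<close>

lemma low_values_tame:
  assumes p: "p \<in> \<Union>EE"
  obtains r where "r > 0"
    "\<And>U x. U \<in> faces \<Longrightarrow> x \<in> ball p r \<Longrightarrow> f x < f p + 1 \<Longrightarrow> x \<in> U \<or> tame U x \<Longrightarrow> tame U p"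
proof -
  have "\<exists>r>0. \<forall>x\<in>ball p r. f x < f p + 1 \<longrightarrow> x \<in> U \<or> tame U x \<longrightarrow> tame U p" if U: "U \<in> faces" for U
  proof -
    consider "tame U p" | "p \<notin> closure U" | "p \<in> closure U" "\<not> tame U p" by blast
    then show ?thesis
    proof cases
      case 1
      then show ?thesis by (intro exI[of _ 1]) simp
    next
      case 2
      then have "p \<in> - closure U" "open (- closure U)" by auto
      then obtain r where r: "r > 0" "ball p r \<subseteq> - closure U" by (meson open_contains_ball)
      have "x \<notin> U" "\<not> tame U x" if "x \<in> ball p r" for x
        using that r(2) closure_subset[of U] unfolding tame_def by blast+
      then show ?thesis using r(1) by blast
    next
      case 3
      obtain s where s: "s > 0" "\<And>x. x \<in> U \<inter> ball p s \<Longrightarrow> f p + 1 < f x"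
        using blow_up_if_not_tame[OF U p 3] by metis
      have "\<not> f x < f p + 1" if x: "x \<in> ball p s" "x \<in> U \<or> tame U x" for x
      proof
        assume low: "f x < f p + 1"
        obtain d where d: "d > 0" "ball x d \<subseteq> ball p s" using x(1) by (meson open_ball open_contains_ball)
        have "\<exists>z\<in>U. z \<in> ball p s \<and> f z < f p + 1"
          using x low tame_approximates[OF _ d(1) low, of U] d(2) by blast
        then show False using s(2) by fastforce
      qed
      then show ?thesis using s(1) by blast
    qed
  qed
  then obtain r where r: "\<And>U. U \<in> faces \<Longrightarrow> r U > 0"
     "\<And>U. U \<in> faces \<Longrightarrow> \<forall>x\<in>ball p (r U). f x < f p + 1 \<longrightarrow> x \<in> U \<or> tame U x \<longrightarrow> tame U p"
    by metis
  define d where "d = Min (insert 1 (r ` faces))"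
  have "d > 0" using r(1) finite_faces by (simp add: d_def)
  moreover have "d \<le> r U" if "U \<in> faces" for U
    using that finite_faces by (simp add: d_def)
  then have "ball p d \<subseteq> ball p (r U)" if "U \<in> faces" for U using that by (simp add: subset_ball)
  ultimately show ?thesis using r(2) that[of d] by blast
qed


section \<open>Counting the links between faces and vertices\<close>

text \<open>
  At a detached point of the net, the graph of \<open>f\<close> is locally a graph over a part of the net.
\<close>

definition detached :: "complex \<Rightarrow> bool" where
  "detached x \<longleftrightarrow> (\<forall>U\<in>faces. \<not> tame U x)"

text \<open>
  Over such an edge the graph of \<open>f\<close> may be connected, so it may link the two ends of the edge. In
  any other edge, an interior point at which some face is tame separates the detached points near one
  end from those near the other.
\<close>

definition detached_edges :: "complex set set" where
  "detached_edges = {e \<in> EE. \<forall>x\<in>e - P. detached x}"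

definition tame_corners :: "(complex set \<times> complex) set" where
  "tame_corners = {(U,v). U \<in> faces \<and> v \<in> P \<and> tame U v}"

lemma tame_edge_at_tame_corner:
  assumes "(U,v) \<in> tame_corners" "e \<in> EE" "v \<in> e" "e - P \<subseteq> closure U"
  obtains r where "r > 0" "\<And>q. q \<in> (e - P) \<inter> ball v r \<Longrightarrow> tame U q"
  using assms tame_nearby[of U v] unfolding tame_corners_def by (smt (verit) Int_iff mem_Collect_eq prod.case subsetD)

lemma vertex_in_closure_edge:
  assumes "e \<in> EE" "v \<in> e" "v \<in> P"
  shows "v \<in> closure (e - P)"
proof -
  obtain a b where ab: "arc_between e a b" "e \<inter> P = {a,b}" "e - P = e - {a,b}"
    using plane_net_edge_arc[OF net assms(1)] .
  have "v = a \<or> v = b" using assms ab(2) by blast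
  then show ?thesis
    using arc_between_interior(3)[OF ab(1)] arc_between_interior(3)[OF arc_between_sym[OF ab(1)]]
    unfolding ab(3) by (auto simp: insert_commute)
qed

lemma card_edge_ends:
  assumes "e \<in> EE"
  shows "card (e \<inter> P) = 2"
proof -
  obtain a b where ab: "arc_between e a b" "e \<inter> P = {a,b}" "e - P = e - {a,b}"
    using plane_net_edge_arc[OF net assms(1)] .
  show ?thesis unfolding ab(2) using arc_between_basic(3)[OF ab(1)] by simp
qed

lemma finite_tame_corners: "finite tame_corners"
proof -
  have "tame_corners \<subseteq> faces \<times> P" unfolding tame_corners_def by blast
  then show ?thesis
    using finite_faces plane_net_finite(2)[OF net] by (metis finite_SigmaI finite_subset)
qed

text \<open>
  A tame corner \<open>(U,v)\<close> owns at least two edges at \<open>v\<close>, namely those bordered by \<open>U\<close>. They are not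
  detached, and \<open>unique_tame_face\<close> implies that different tame corners at \<open>v\<close> own different edges. As
  an edge has two ends, double counting of the pairs of an edge and an end of it yields the bound.
\<close>

lemma card_tame_corners: "card tame_corners \<le> card (EE - detached_edges)"
proof -
  define edges_at where
    "edges_at = (\<lambda>(U,v). {e \<in> EE. v \<in> e \<and> e - P \<subseteq> closure U})"
  have fin: "finite EE" "finite P" using plane_net_finite[OF net] by simp_all
  have two: "2 \<le> card (edges_at c)" if c: "c \<in> tame_corners" for c
  proof -
    obtain U v where c': "c = (U,v)" by force
    have "U \<in> faces" "v \<in> P" "v \<in> closure U"
      using c unfolding c' tame_corners_def tame_def by simp_all
    then show ?thesis using face_borders_two_edges[OF net] unfolding c' edges_at_def by simp
  qed
  have same: "U = U'"
    if A: "(U,v) \<in> tame_corners" "e \<in> edges_at (U,v)"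
      and B: "(U',v) \<in> tame_corners" "e \<in> edges_at (U',v)" for U U' v e
  proof -
    have e: "e \<in> EE" "v \<in> e" "e - P \<subseteq> closure U" "e - P \<subseteq> closure U'"
      using A(2) B(2) unfolding edges_at_def by simp_all
    have UU: "U \<in> faces" "U' \<in> faces" "v \<in> P" using A(1) B(1) unfolding tame_corners_def by simp_all
    obtain r where r: "r > 0" "\<And>q. q \<in> (e - P) \<inter> ball v r \<Longrightarrow> tame U q"
      using tame_edge_at_tame_corner[OF A(1) e(1,2,3)] by metis
    obtain r' where r': "r' > 0" "\<And>q. q \<in> (e - P) \<inter> ball v r' \<Longrightarrow> tame U' q"
      using tame_edge_at_tame_corner[OF B(1) e(1,2,4)] by metis
    obtain q where q: "q \<in> e - P" "dist q v < min r r'"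
      using vertex_in_closure_edge[OF e(1,2) UU(3)] r(1) r'(1)
      unfolding closure_approachable by (metis min_less_iff_conj)
    then have "tame U q" "tame U' q" using r(2)[of q] r'(2)[of q] by (simp_all add: dist_commute)
    then show "U = U'" using unique_tame_face[OF e(1) q(1) UU(1,2)] by simp
  qed
  have inj: "inj_on (\<lambda>((U,v),e). (e,v)) (SIGMA c:tame_corners. edges_at c)"
    by (rule inj_onI) (use same in \<open>auto simp del: split_paired_All\<close>)
  have sub: "(\<lambda>((U,v),e). (e,v)) ` (SIGMA c:tame_corners. edges_at c) \<subseteq> (SIGMA e:EE - detached_edges. e \<inter> P)"
  proof (rule image_subsetI, clarsimp)
    fix U v e assume A: "(U,v) \<in> tame_corners" "e \<in> edges_at (U,v)"
    have e: "e \<in> EE" "v \<in> e" "e - P \<subseteq> closure U" using A(2) unfolding edges_at_def by simp_all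
    have U: "U \<in> faces" "v \<in> P" using A(1) unfolding tame_corners_def by simp_all
    obtain r where r: "r > 0" "\<And>q. q \<in> (e - P) \<inter> ball v r \<Longrightarrow> tame U q"
      using tame_edge_at_tame_corner[OF A(1) e] by metis
    obtain q where q: "q \<in> e - P" "dist q v < r"
      using vertex_in_closure_edge[OF e(1,2) U(2)] r(1) unfolding closure_approachable by metis
    then have "tame U q" using r(2)[of q] by (simp add: dist_commute)
    then have "e \<notin> detached_edges" using q(1) U(1) unfolding detached_edges_def detached_def by blast
    then show "e \<in> EE \<and> e \<notin> detached_edges \<and> v \<in> e \<and> v \<in> P" using e U by simp
  qed
  have "2 * card tame_corners = (\<Sum>c\<in>tame_corners. 2)" by simp
  also have "\<dots> \<le> (\<Sum>c\<in>tame_corners. card (edges_at c))" using two by (rule sum_mono)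
  also have "\<dots> = card (SIGMA c:tame_corners. edges_at c)"
    using finite_tame_corners fin by (intro card_SigmaI[symmetric]) (auto simp: edges_at_def)
  also have "\<dots> = card ((\<lambda>((U,v),e). (e,v)) ` (SIGMA c:tame_corners. edges_at c))"
    using card_image[OF inj] by simp
  also have "\<dots> \<le> card (SIGMA e:EE - detached_edges. e \<inter> P)"
    using sub fin by (intro card_mono) auto
  also have "\<dots> = (\<Sum>e\<in>EE - detached_edges. card (e \<inter> P))"
    using fin by (intro card_SigmaI) auto
  also have "\<dots> = (\<Sum>e\<in>EE - detached_edges. 2)" by (intro sum.cong) (auto simp: card_edge_ends)
  finally show ?thesis by simp
qed

lemma colouring:
  "\<exists>(hf :: complex set \<Rightarrow> bool) (hv :: complex \<Rightarrow> bool).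
    (\<forall>U\<in>faces. \<forall>v\<in>P. tame U v \<longrightarrow> hf U = hv v) \<and>
    (\<forall>e\<in>detached_edges. \<forall>v\<in>e \<inter> P. \<forall>w\<in>e \<inter> P. hv v = hv w) \<and>
    ((\<exists>U\<in>faces. hf U) \<or> (\<exists>v\<in>P. hv v)) \<and>
    ((\<exists>U\<in>faces. \<not> hf U) \<or> (\<exists>v\<in>P. \<not> hv v))"
proof -
  have fin: "finite EE" "finite P" using plane_net_finite[OF net] by simp_all
  have "\<forall>e. \<exists>ab. e \<in> EE \<longrightarrow> e \<inter> P = {fst ab, snd ab}"
    using plane_net_edge_arc[OF net] by (metis fst_conv snd_conv)
  then obtain ends where ends: "\<And>e. e \<in> EE \<Longrightarrow> e \<inter> P = {fst (ends e), snd (ends e)}" by metis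
  define R1 :: "((complex set + complex) \<times> (complex set + complex)) set"
    where "R1 = (\<lambda>(U,v). (Inl U, Inr v)) ` tame_corners"
  define R2 :: "((complex set + complex) \<times> (complex set + complex)) set"
    where "R2 = (\<lambda>e. (Inr (fst (ends e)), Inr (snd (ends e)))) ` detached_edges"
  define N :: "(complex set + complex) set" where "N = Inl ` faces \<union> Inr ` P"
  have det_edge: "detached_edges \<subseteq> EE" "finite detached_edges"
    using fin unfolding detached_edges_def by auto
  have finR: "finite (R1 \<union> R2)" "finite N"
    using finite_tame_corners finite_faces fin det_edge by (simp_all add: R1_def R2_def N_def)
  have "card (R1 \<union> R2) \<le> card R1 + card R2" by (rule card_Un_le)
  also have "\<dots> \<le> card tame_corners + card detached_edges"
    unfolding R1_def R2_def by (intro add_mono card_image_le finite_tame_corners det_edge)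
  also have "\<dots> \<le> card (EE - detached_edges) + card detached_edges" using card_tame_corners by simp
  also have "\<dots> = card EE" using det_edge fin by (metis card_Diff_subset card_mono le_add_diff_inverse2)
  finally have "card (R1 \<union> R2) \<le> card EE" .
  moreover have "card EE + 2 \<le> card N"
  proof -
    obtain F where F: "F \<subseteq> faces" "card EE + 2 \<le> card P + card F"
      using plane_net_Euler[OF net] by blast
    have "card N = card faces + card P"
      unfolding N_def using finite_faces fin by (subst card_Un_disjoint) (auto simp: card_image)
    then show ?thesis using F card_mono[OF finite_faces F(1)] by simp
  qed
  ultimately have "card (R1 \<union> R2) + 2 \<le> card N" by simp
  then obtain h where h: "\<And>x y. (x,y) \<in> R1 \<union> R2 \<Longrightarrow> h x = h y" "\<exists>x\<in>N. h x" "\<exists>x\<in>N. \<not> h x"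
    using two_colouring[OF finR] by metis
  have "h (Inl U) = h (Inr v)" if "U \<in> faces" "v \<in> P" "tame U v" for U v
  proof -
    have "(U,v) \<in> tame_corners" using that by (simp add: tame_corners_def)
    then have "(Inl U, Inr v) \<in> R1 \<union> R2" unfolding R1_def by force
    then show ?thesis by (rule h(1))
  qed
  moreover have "h (Inr v) = h (Inr w)" if e: "e \<in> detached_edges" "v \<in> e \<inter> P" "w \<in> e \<inter> P" for e v w
  proof -
    have "h (Inr (fst (ends e))) = h (Inr (snd (ends e)))"
      using h(1) e(1) unfolding R2_def by blast
    moreover have "e \<in> EE" using e(1) det_edge(1) by blast
    then have "v \<in> {fst (ends e), snd (ends e)}" "w \<in> {fst (ends e), snd (ends e)}"
      using e(2,3) unfolding ends[OF \<open>e \<in> EE\<close>] by simp_all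
    ultimately show ?thesis by auto
  qed
  moreover have "(\<exists>U\<in>faces. h (Inl U)) \<or> (\<exists>v\<in>P. h (Inr v))"
    "(\<exists>U\<in>faces. \<not> h (Inl U)) \<or> (\<exists>v\<in>P. \<not> h (Inr v))"
    using h(2,3) by (auto simp: N_def)
  ultimately show ?thesis
    by (intro exI[of _ "\<lambda>U. h (Inl U)"] exI[of _ "\<lambda>v. h (Inr v)"]) blast
qed

section \<open>A locally constant colouring of the graph\<close>

text \<open>
  An edge that is not detached may change colour at an interior point \<open>q\<close> that is not detached. There
  the graph of \<open>f\<close> takes its colour from a face instead of \<open>k\<close>.
\<close>

lemma edge_colouring:
  assumes e: "e \<in> EE"
    and h: "e \<in> detached_edges \<Longrightarrow> \<forall>v\<in>e \<inter> P. \<forall>w\<in>e \<inter> P. h v = h w"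
  shows "\<exists>k::complex \<Rightarrow> bool. (\<forall>v\<in>e \<inter> P. k v = h v) \<and>
           (\<forall>x\<in>e. x \<in> P \<or> detached x \<longrightarrow> (\<exists>r>0. \<forall>y\<in>e \<inter> ball x r. k y = k x))"
proof (cases "e \<in> detached_edges")
  case True
  obtain a b where ab: "arc_between e a b" "e \<inter> P = {a,b}" "e - P = e - {a,b}"
    using plane_net_edge_arc[OF net e] .
  have "a \<in> e \<inter> P" unfolding ab(2) by simp
  then have "\<forall>v\<in>e \<inter> P. h a = h v" using h[OF True] by metis
  then show ?thesis by (intro exI[of _ "\<lambda>_. h a"] conjI) (auto intro: exI[of _ 1])
next
  case False
  obtain a b where ab: "arc_between e a b" "e \<inter> P = {a,b}" "e - P = e - {a,b}"
    using plane_net_edge_arc[OF net e] .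
  obtain q where q: "q \<in> e - P" "\<not> detached q" using False e unfolding detached_edges_def by blast
  then have "q \<in> e" "q \<noteq> a" "q \<noteq> b" using ab(3) by blast+
  then obtain A B where AB: "arc_between A a q" "arc_between B q b" "e = A \<union> B" "A \<inter> B = {q}"
    using arc_between_split[OF ab(1)] by metis
  have cl: "closed A" "closed B" "a \<in> A" "b \<in> B"
    using arc_between_basic[OF AB(1)] arc_between_basic[OF AB(2)] by simp_all
  have AB_q: "x = q" if "x \<in> A" "x \<in> B" for x
  proof -
    have "x \<in> A \<inter> B" using that by simp
    then show ?thesis unfolding AB(4) by simp
  qed
  have "b \<notin> A" using AB_q[of b] cl(4) \<open>q \<noteq> b\<close> by metis
  define k where "k x = (if x \<in> A then h a else h b)" for x
  have "\<exists>r>0. \<forall>y\<in>e \<inter> ball x r. k y = k x" if x: "x \<in> e" "x \<in> P \<or> detached x" for x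
  proof -
    have "x \<noteq> q" using x q by blast
    show ?thesis
    proof (cases "x \<in> A")
      case True
      then have "x \<in> - B" "open (- B)" using AB_q[of x] \<open>x \<noteq> q\<close> cl(2) by auto
      then obtain r where "r > 0" "ball x r \<subseteq> - B" by (meson open_contains_ball)
      then show ?thesis using True AB(3) unfolding k_def by (intro exI[of _ r]) auto
    next
      case False
      then have "x \<in> - A" "open (- A)" using cl(1) by blast+
      then obtain r where "r > 0" "ball x r \<subseteq> - A" by (meson open_contains_ball)
      then show ?thesis using False unfolding k_def by (intro exI[of _ r]) auto
    qed
  qed
  moreover have "\<forall>v\<in>e \<inter> P. k v = h v" unfolding ab(2) k_def using cl(3) \<open>b \<notin> A\<close> by simp
  ultimately show ?thesis by blast
qed

text \<open>
  Local constancy at \<open>p\<close> is a matter of points \<open>x\<close> near \<open>p\<close> with \<open>f x\<close> near \<open>f p\<close>. If \<open>x\<close> lies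
  in a face, or some face is tame at \<open>x\<close>, then this face is tame at \<open>p\<close> as well
  (\<open>low_values_tame\<close>) and gives its colour to both points. Otherwise \<open>x\<close> is a detached point of
  an edge, and the colouring of that edge applies.
\<close>

theorem graph_not_connected: "\<not> connected (graph_of f)"
proof -
  obtain hf hv where
    corner: "\<forall>U\<in>faces. \<forall>v\<in>P. tame U v \<longrightarrow> hf U = hv v"
    and det_edge: "\<forall>e\<in>detached_edges. \<forall>v\<in>e \<inter> P. \<forall>w\<in>e \<inter> P. hv v = hv w"
    and pos: "(\<exists>U\<in>faces. hf U) \<or> (\<exists>v\<in>P. hv v)"
    and neg: "(\<exists>U\<in>faces. \<not> hf U) \<or> (\<exists>v\<in>P. \<not> hv v)"
    using colouring by (elim exE conjE)
  have "\<forall>e\<in>EE. \<exists>k::complex \<Rightarrow> bool. (\<forall>v\<in>e \<inter> P. k v = hv v) \<and>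
           (\<forall>x\<in>e. x \<in> P \<or> detached x \<longrightarrow> (\<exists>r>0. \<forall>y\<in>e \<inter> ball x r. k y = k x))"
    by (rule ballI, rule edge_colouring, assumption) (rule bspec[OF det_edge])
  from bchoice[OF this] obtain k :: "complex set \<Rightarrow> complex \<Rightarrow> bool" where
    kk: "\<forall>e\<in>EE. (\<forall>v\<in>e \<inter> P. k e v = hv v) \<and>
           (\<forall>x\<in>e. x \<in> P \<or> detached x \<longrightarrow> (\<exists>r>0. \<forall>y\<in>e \<inter> ball x r. k e y = k e x))" ..
  have k: "k e v = hv v" if "e \<in> EE" "v \<in> e \<inter> P" for e v
    using kk that by simp
  have k_loc: "\<exists>r>0. \<forall>y\<in>e \<inter> ball x r. k e y = k e x"
    if "e \<in> EE" "x \<in> e" "x \<in> P \<or> detached x" for e x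
    using bspec[OF kk that(1)] that(2,3) by blast
  \<comment> \<open>The interior of an edge is coloured like the tame face, if there is one, and by
    \<open>k\<close> at the detached points. \<open>THE\<close> and \<open>SOME\<close> pick unique objects.\<close>
  define c where "c x =
    (if x \<notin> \<Union>EE then hf (connected_component_set (- \<Union>EE) x)
     else if x \<in> P then hv x
     else if detached x then k (THE e. e \<in> EE \<and> x \<in> e) x
     else hf (SOME U. U \<in> faces \<and> tame U x))" for x
  have E: "closed (\<Union>EE)" using plane_net_connected[OF net] compact_imp_closed by metis
  have PE: "P \<subseteq> \<Union>EE" by (rule plane_net_finite(3)[OF net])
  have c_face: "c x = hf U" if "U \<in> faces" "x \<in> U" for x U
  proof -
    have "x \<notin> \<Union>EE" using that in_components_subset by fastforce
    moreover have "U = connected_component_set (- \<Union>EE) x"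
      using that by (metis connected_component_eq components_iff)
    ultimately show ?thesis by (simp add: c_def)
  qed
  have c_vertex: "c x = hv x" if "x \<in> P" for x using that PE by (auto simp: c_def)
  have c_detached: "c x = k e x" if "e \<in> EE" "x \<in> e - P" "detached x" for e x
  proof -
    have "(THE e. e \<in> EE \<and> x \<in> e) = e"
      using that plane_net_unique_edge[OF net] by (intro the_equality) blast+
    then show ?thesis using that by (auto simp: c_def)
  qed
  have c_tame: "c x = hf U" if "e \<in> EE" "x \<in> e - P" "U \<in> faces" "tame U x" for e x U
  proof -
    have "(SOME U. U \<in> faces \<and> tame U x) = U"
      using that unique_tame_face[OF that(1,2)] by (intro some_equality) blast+
    moreover have "\<not> detached x" using that unfolding detached_def by blast
    ultimately show ?thesis using that by (auto simp: c_def)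
  qed
  have loc: "\<exists>r>0. \<forall>x\<in>ball p r. dist (f x) (f p) < 1 \<longrightarrow> c x = c p" for p
  proof -
    consider "p \<notin> \<Union>EE" | "p \<in> P" | e where "e \<in> EE" "p \<in> e - P" by blast
    then show ?thesis
    proof cases
      case 1
      define U where "U = connected_component_set (- \<Union>EE) p"
      have U: "U \<in> faces" "p \<in> U" using 1 unfolding U_def components_def by auto
      have "open U" using E open_components[of "- \<Union>EE" U] U(1) by blast
      then obtain r where "r > 0" "ball p r \<subseteq> U" using U(2) by (meson open_contains_ball)
      then show ?thesis using c_face[OF U(1)] U(2) by (intro exI[of _ r]) auto
    next
      case 2
      have pE: "p \<in> \<Union>EE" using 2 PE by blast
      obtain r where r: "r > 0" "P \<inter> ball p r = {p}" "\<And>e. e \<in> EE \<Longrightarrow> e \<inter> ball p r \<noteq> {} \<Longrightarrow> p \<in> e"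
        using plane_net_near_vertex[OF net 2] by metis
      obtain s where s: "s > 0"
        "\<And>U x. U \<in> faces \<Longrightarrow> x \<in> ball p s \<Longrightarrow> f x < f p + 1 \<Longrightarrow> x \<in> U \<or> tame U x \<Longrightarrow> tame U p"
        using low_values_tame[OF pE] by metis
      have "\<forall>e\<in>EE. \<exists>d>0. p \<in> e \<longrightarrow> (\<forall>y\<in>e \<inter> ball p d. k e y = k e p)"
        using k_loc 2 by (metis zero_less_one)
      then obtain d where d: "\<And>e. e \<in> EE \<Longrightarrow> d e > 0"
        "\<And>e y. e \<in> EE \<Longrightarrow> p \<in> e \<Longrightarrow> y \<in> e \<inter> ball p (d e) \<Longrightarrow> k e y = k e p"
        by metis
      define t where "t = Min (insert r (insert s (d ` EE)))"
      have fin: "finite EE" by (rule plane_net_finite(1)[OF net])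
      have t: "t \<le> r" "t \<le> s"
        unfolding t_def using fin by (intro Min_le; simp)+
      have td: "t \<le> d e" if "e \<in> EE" for e
        unfolding t_def using that fin by (intro Min_le; simp)
      have "t \<in> insert r (insert s (d ` EE))" unfolding t_def using fin by (intro Min_in) auto
      then have "t > 0" using r(1) s(1) d(1) by blast
      have "c x = c p" if x: "x \<in> ball p t" "dist (f x) (f p) < 1" for x
      proof -
        have xb: "x \<in> ball p r" "x \<in> ball p s" using x(1) t by auto
        have low: "f x < f p + 1" using x(2) by (simp add: dist_real_def)
        have face: "hf U = c p" if "U \<in> faces" "x \<in> U \<or> tame U x" for U
          using bspec[OF bspec[OF corner that(1)] 2] s(2)[OF that(1) xb(2) low that(2)] c_vertex[OF 2] by simp
        consider "x \<notin> \<Union>EE" | "x \<in> P" | e where "e \<in> EE" "x \<in> e - P" by blast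
        then show ?thesis
        proof cases
          case 1
          then obtain U where "U \<in> faces" "x \<in> U" using Union_components[of "- \<Union>EE"] by blast
          then show ?thesis using face c_face by metis
        next
          case 2
          then have "x \<in> P \<inter> ball p r" using xb(1) by simp
          then show ?thesis unfolding r(2) by simp
        next
          case (3 e)
          show ?thesis
          proof (cases "detached x")
            case True
            have "p \<in> e" using r(3)[OF 3(1)] 3(2) xb(1) by blast
            moreover have "x \<in> e \<inter> ball p (d e)" using 3 x(1) td[OF 3(1)] by auto
            ultimately have "k e x = k e p" using d(2) 3(1) by blast
            moreover have "k e p = hv p" using k[OF 3(1)] \<open>p \<in> e\<close> 2 by blast
            ultimately show ?thesis using c_detached[OF 3 True] c_vertex[OF 2] by simp
          next
            case False
            then obtain U where "U \<in> faces" "tame U x" unfolding detached_def by blast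
            then show ?thesis using face c_tame[OF 3] by metis
          qed
        qed
      qed
      then show ?thesis using \<open>t > 0\<close> by blast
    next
      case (3 e)
      have pE: "p \<in> \<Union>EE" using 3 by blast
      obtain r where r: "r > 0" "\<Union>EE \<inter> ball p r \<subseteq> e - P"
        using plane_net_near_edge[OF net 3] .
      obtain s where s: "s > 0"
        "\<And>U x. U \<in> faces \<Longrightarrow> x \<in> ball p s \<Longrightarrow> f x < f p + 1 \<Longrightarrow> x \<in> U \<or> tame U x \<Longrightarrow> tame U p"
        using low_values_tame[OF pE] by metis
      have face: "c x = c p"
        if x: "x \<in> ball p s" "x \<in> ball p r" "f x < f p + 1" and U: "U \<in> faces" "x \<in> U \<or> tame U x" for x U
      proof -
        have p: "c p = hf U" using c_tame[OF 3 U(1)] s(2)[OF U(1) x(1,3) U(2)] by simp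
        show ?thesis
        proof (cases "x \<in> U")
          case True
          then show ?thesis using p c_face[OF U(1)] by simp
        next
          case False
          show ?thesis
          proof (cases "x \<in> \<Union>EE")
            case True
            then have "x \<in> e - P" using r(2) x(2) by blast
            then show ?thesis using c_tame[OF 3(1)] U False p by simp
          next
            case x': False
            \<comment> \<open>A point off the net in the closure of a face lies in that face.\<close>
            have "closure U \<subseteq> U \<union> \<Union>EE"
              using frontier_of_components_closed_complement[OF E U(1)]
              unfolding frontier_def using interior_subset[of U] by blast
            then show ?thesis using x' U False unfolding tame_def by blast
          qed
        qed
      qed
      show ?thesis
      proof (cases "detached p")
        case True
        obtain d where d: "d > 0" "\<And>y. y \<in> e \<inter> ball p d \<Longrightarrow> k e y = k e p"
          using k_loc[OF 3(1), of p] 3(2) True by blast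
        have "c x = c p" if x: "x \<in> ball p (min d (min r s))" "dist (f x) (f p) < 1" for x
        proof -
          have xb: "x \<in> ball p s" "x \<in> ball p r" "x \<in> ball p d" using x(1) by auto
          have low: "f x < f p + 1" using x(2) by (simp add: dist_real_def)
          show ?thesis
          proof (cases "\<exists>U\<in>faces. x \<in> U \<or> tame U x")
            case True
            then show ?thesis using face[OF xb(1,2) low] by blast
          next
            case False
            then have "x \<in> \<Union>EE" using Union_components[of "- \<Union>EE"] by blast
            then have xe: "x \<in> e - P" using r(2) xb(2) by blast
            have "detached x" using False unfolding detached_def by blast
            then have "c x = k e x" using c_detached[OF 3(1) xe] by simp
            also have "\<dots> = k e p" using d(2) xe xb(3) by blast
            also have "\<dots> = c p" using c_detached[OF 3 True] by simp
            finally show ?thesis .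
          qed
        qed
        moreover have "min d (min r s) > 0" using d(1) r(1) s(1) by simp
        ultimately show ?thesis by blast
      next
        case False
        then obtain U where U: "U \<in> faces" "tame U p" unfolding detached_def by blast
        obtain d M where d: "d > 0" "\<And>q. q \<in> ball p d \<Longrightarrow> q \<in> closure U \<Longrightarrow> tame U q \<and> f q \<le> M"
          using tame_nearby[OF U(2)] by metis
        have eU: "e - P \<subseteq> closure U"
          using face_borders_whole_edge[OF net 3(1) U(1) 3(2)] U(2) unfolding tame_def by blast
        have "c x = c p" if x: "x \<in> ball p (min d (min r s))" "dist (f x) (f p) < 1" for x
        proof -
          have xb: "x \<in> ball p s" "x \<in> ball p r" "x \<in> ball p d" using x(1) by auto
          have low: "f x < f p + 1" using x(2) by (simp add: dist_real_def)
          have "\<exists>V\<in>faces. x \<in> V \<or> tame V x"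
          proof (cases "x \<in> \<Union>EE")
            case True
            then have "tame U x" using r(2) xb(2) eU d(2)[OF xb(3)] by blast
            then show ?thesis using U(1) by blast
          next
            case False
            then show ?thesis using Union_components[of "- \<Union>EE"] by blast
          qed
          then show ?thesis using face[OF xb(1,2) low] by blast
        qed
        moreover have "min d (min r s) > 0" using d(1) r(1) s(1) by simp
        ultimately show ?thesis by blast
      qed
    qed
  qed
  have attained: "\<exists>x. c x = b" if "(\<exists>U\<in>faces. hf U = b) \<or> (\<exists>v\<in>P. hv v = b)" for b
    using that
  proof
    assume "\<exists>U\<in>faces. hf U = b"
    then obtain U where U: "U \<in> faces" "hf U = b" by blast
    obtain x where "x \<in> U" using in_components_nonempty[OF U(1)] by blast
    then show ?thesis using c_face[OF U(1)] U(2) by blast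
  next
    assume "\<exists>v\<in>P. hv v = b"
    then show ?thesis using c_vertex by blast
  qed
  obtain x where "c x" using attained[of True] pos by auto
  moreover obtain y where "\<not> c y" using attained[of False] neg by auto
  ultimately show ?thesis by (rule not_connected_graph_of[OF loc])
qed

end


section \<open>From networks to plane graphs\<close>

lemma circle_minus_point_connected:
  fixes C :: "'a::topological_space set"
  assumes "C homeomorphic sphere (0::'b::euclidean_space) 1" "x \<in> C"
  shows "connected (C - {x})"
proof -
  obtain h k where hk: "homeomorphism C (sphere (0::'b) 1) h k"
    using assms(1) unfolding homeomorphic_def by blast
  have hx: "h x \<in> sphere 0 1" using hk assms(2) unfolding homeomorphism_def by blast
  then have "h x \<noteq> 0" by auto
  then have "sphere 0 1 - {h x} homeomorphic {y. h x \<bullet> y = 0}"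
    using homeomorphic_punctured_sphere_hyperplane[of 1 "h x" 0 "h x" 0] hx by simp
  then have conn: "connected (sphere 0 1 - {h x})"
    using homeomorphic_connectedness convex_connected[OF convex_hyperplane] by blast
  have cont: "continuous_on (sphere 0 1 - {h x}) k"
    using hk unfolding homeomorphism_def by (meson Diff_subset continuous_on_subset)
  have inv: "\<And>y. y \<in> C \<Longrightarrow> k (h y) = y \<and> h y \<in> sphere 0 1"
     "\<And>z. z \<in> sphere 0 1 \<Longrightarrow> h (k z) = z \<and> k z \<in> C"
    using hk unfolding homeomorphism_def by blast+
  have "k ` (sphere 0 1 - {h x}) = C - {x}"
  proof
    show "k ` (sphere 0 1 - {h x}) \<subseteq> C - {x}"
    proof (rule image_subsetI)
      fix z assume "z \<in> sphere 0 1 - {h x}"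
      then have "h (k z) = z" "k z \<in> C" "z \<noteq> h x" using inv(2) by blast+
      then show "k z \<in> C - {x}" by auto
    qed
    show "C - {x} \<subseteq> k ` (sphere 0 1 - {h x})"
    proof
      fix y assume y: "y \<in> C - {x}"
      then have "k (h y) = y" "h y \<in> sphere 0 1" "k (h x) = x" using inv(1) assms(2) by blast+
      then show "y \<in> k ` (sphere 0 1 - {h x})" using y by (intro image_eqI[of _ _ "h y"]) auto
    qed
  qed
  then show ?thesis using connected_continuous_image[OF cont conn] by simp
qed

lemma dangling_arc_disconnects:
  fixes X :: "'a::t1_space set"
  assumes cl: "closed X" "closed Y" "X \<inter> Y = {c}"
    and ad: "a \<in> X" "a \<noteq> c" "d \<in> Y" "d \<noteq> c"
  shows "\<not> connected (X \<union> Y - {c})"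
proof
  assume conn: "connected (X \<union> Y - {c})"
  have inter: "x = c" if "x \<in> X" "x \<in> Y" for x
  proof -
    have "x \<in> X \<inter> Y" using that by simp
    then show ?thesis unfolding cl(3) by simp
  qed
  have "X \<inter> Y \<inter> (X \<union> Y - {c}) = {}" using inter by blast
  moreover have "X \<inter> (X \<union> Y - {c}) \<noteq> {}" "Y \<inter> (X \<union> Y - {c}) \<noteq> {}" using ad by blast+
  moreover have "X \<union> Y - {c} \<subseteq> X \<union> Y" by blast
  ultimately show False using conn cl(1,2) unfolding connected_closed by blast
qed

text \<open>
  For a network it has to be shown that the first two arcs have the same ends. If the end \<open>a\<close> of \<open>A\<close> were
  free, the first of the points \<open>c\<close>, \<open>d\<close> on the way from \<open>a\<close> along \<open>A\<close> would be a cut point of the circle.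
\<close>

lemma circle_arcs_common_end:
  fixes A B :: "'a::real_normed_vector set"
  assumes A: "arc_between A a b" and B: "arc_between B c d" and AB: "A \<inter> B = {c,d}"
    and circle: "(A \<union> B) homeomorphic sphere (0::'b::euclidean_space) 1"
  shows "a \<in> {c,d}"
proof (rule ccontr)
  assume "a \<notin> {c,d}"
  then have ac: "a \<noteq> c" "a \<noteq> d" by auto
  have cd: "c \<in> A" "d \<in> A" "c \<in> B" "d \<in> B" "c \<noteq> d" "closed B"
    using AB arc_between_basic(3,7)[OF B] by blast+
  have meet: "x = c \<or> x = d" if "x \<in> A" "x \<in> B" for x
  proof -
    have "x \<in> A \<inter> B" using that by simp
    then show ?thesis unfolding AB by simp
  qed
  have absurd: False
    if "closed X" "closed Z" "A = X \<union> Z" "X \<inter> Z = {p}" "a \<in> X" "q \<notin> X" "{p,q} = {c,d}" for X Z p q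
  proof -
    have pq: "p \<in> B" "q \<in> B" "p \<noteq> q" "a \<noteq> p" "p \<in> A"
      using that(7) cd ac by (auto simp: doubleton_eq_iff)
    have pX: "p \<in> X" using that(4) by blast
    have "x = p" if "x \<in> X" "x \<in> Z \<union> B" for x
    proof (cases "x \<in> Z")
      case True
      then have "x \<in> X \<inter> Z" using that(1) by simp
      then show ?thesis unfolding \<open>X \<inter> Z = {p}\<close> by simp
    next
      case False
      then have "x \<in> {p,q}" using meet that \<open>A = X \<union> Z\<close> \<open>{p,q} = {c,d}\<close> by auto
      then show ?thesis using that(1) \<open>q \<notin> X\<close> by blast
    qed
    then have "X \<inter> (Z \<union> B) = {p}" using pX pq(1) by blast
    then have "\<not> connected (X \<union> (Z \<union> B) - {p})"
      using that cd(6) pq by (intro dangling_arc_disconnects[of _ _ _ a q] closed_Un) auto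
    moreover have "X \<union> (Z \<union> B) = A \<union> B" using that(3) by blast
    ultimately show False using circle_minus_point_connected[OF circle, of p] pq(1) by simp
  qed
  \<comment> \<open>The hypotheses of \<open>absurd\<close> hold at the first of the two points on the way through \<open>A\<close> from \<open>a\<close>.\<close>
  have first: False if pq: "{p,q} = {c,d}" and pb: "p \<noteq> b" for p q
  proof -
    have p: "p \<in> A" "p \<noteq> a" "q \<in> A" "q \<noteq> a" "p \<noteq> q" using pq cd ac by (auto simp: doubleton_eq_iff)
    obtain X Y where XY: "arc_between X a p" "arc_between Y p b" "A = X \<union> Y" "X \<inter> Y = {p}"
      using arc_between_split[OF A p(1,2) pb] by metis
    note basic = arc_between_basic[OF XY(1)] arc_between_basic[OF XY(2)]
    show False
    proof (cases "q \<in> X")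
      case False
      then show False using absurd[OF _ _ XY(3,4) _ _ pq] basic by blast
    next
      case True
      obtain X1 X2 where X12: "arc_between X1 a q" "arc_between X2 q p" "X = X1 \<union> X2" "X1 \<inter> X2 = {q}"
        using arc_between_split[OF XY(1) True] p by metis
      note basic' = arc_between_basic[OF X12(1)] arc_between_basic[OF X12(2)]
      have "x = q" if "x \<in> X1" "x \<in> X2" for x
      proof -
        have "x \<in> X1 \<inter> X2" using that by simp
        then show ?thesis unfolding X12(4) by simp
      qed
      then have p1: "p \<notin> X1" using basic' p(5) by blast
      have "X1 \<inter> Y \<subseteq> {p}" using XY(4) X12(3) by blast
      then have "X1 \<inter> Y = {}" using p1 by blast
      then have "X1 \<inter> (X2 \<union> Y) = {q}" unfolding Int_Un_distrib X12(4) by simp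
      moreover have "A = X1 \<union> (X2 \<union> Y)" using XY(3) X12(3) by blast
      moreover have "closed X1" "closed (X2 \<union> Y)" "a \<in> X1" using basic basic' by blast+
      moreover have "{q,p} = {c,d}" using pq by (simp add: insert_commute)
      ultimately show False using absurd p1 by metis
    qed
  qed
  show False
  proof (cases "c = b")
    case True
    then show False using first[of d c] cd(5) by (simp add: insert_commute)
  next
    case False
    then show False using first[of c d] by simp
  qed
qed

lemma circle_arcs_same_ends:
  fixes A B :: "'a::real_normed_vector set"
  assumes A: "arc_between A a b" and B: "arc_between B c d" and AB: "A \<inter> B = {c,d}"
    and circle: "(A \<union> B) homeomorphic sphere (0::'b::euclidean_space) 1"
  shows "arc_between A c d"
proof -
  have "a \<in> {c,d}" by (rule circle_arcs_common_end[OF A B AB circle])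
  moreover have "b \<in> {c,d}"
    by (rule circle_arcs_common_end[OF arc_between_sym[OF A] B AB circle])
  ultimately have "(a = c \<and> b = d) \<or> (a = d \<and> b = c)"
    using arc_between_basic(3)[OF A] by auto
  then show ?thesis using A arc_between_sym[OF A] by blast
qed

lemma plane_net_refine:
  assumes N: "plane_net EE P" and x: "x \<in> \<Union>EE"
  shows "\<exists>EE'. plane_net EE' (insert x P) \<and> \<Union>EE' = \<Union>EE"
proof (cases "x \<in> P")
  case True
  then show ?thesis using N by (metis insert_absorb)
next
  case False
  obtain e where e: "e \<in> EE" "x \<in> e" using x by blast
  obtain a b where ab: "arc_between e a b" "e \<inter> P = {a,b}" "e - P = e - {a,b}"
    using plane_net_edge_arc[OF N e(1)] .
  have "x \<in> e - {a,b}" unfolding ab(3)[symmetric] using False e by simp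
  then have xab: "x \<noteq> a" "x \<noteq> b" by auto
  obtain A B where AB: "arc_between A a x" "arc_between B x b" "e = A \<union> B" "A \<inter> B = {x}"
    using arc_between_split[OF ab(1) e(2) xab] .
  have AB_edge: "A \<union> B \<in> EE" using e(1) AB(3) by simp
  have "plane_net (insert A (insert B (EE - {A \<union> B}))) (insert x P)"
    using ab(2) unfolding AB(3) by (rule plane_net.subdivide[OF N AB_edge _ AB(1,2,4)])
  then show ?thesis using Union_subdivide[OF AB_edge] by blast
qed

lemma plane_net_of_arcs:
  fixes A :: "nat \<Rightarrow> complex set"
  assumes n: "2 \<le> n" and arcs: "\<And>i. i \<in> {1..n} \<Longrightarrow> arc_between (A i) (a i) (b i)"
    and circle: "arc_between (A 1) (a 2) (b 2)"
    and chords: "\<And>k. k \<in> {2..n} \<Longrightarrow> A k \<inter> (\<Union>i\<in>{1..k - 1}. A i) = {a k, b k}"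
  shows "\<exists>EE P. plane_net EE P \<and> \<Union>EE = (\<Union>i\<in>{1..n}. A i)"
proof -
  have "\<exists>EE P. plane_net EE P \<and> \<Union>EE = (\<Union>i\<in>{1..m}. A i)" if "2 \<le> m" "m \<le> n" for m
    using that
  proof (induction m rule: dec_induct)
    case base
    have two: "{1..2} = {1,2::nat}" by auto
    have "A 2 \<inter> A 1 = {a 2, b 2}" using chords[of 2] n by simp
    then have "A 1 \<inter> A 2 = {a 2, b 2}" by (simp only: Int_commute)
    then have "plane_net {A 1, A 2} {a 2, b 2}"
      using circle arcs[of 2] n by (intro plane_net.circle) simp_all
    moreover have "\<Union>{A 1, A 2} = (\<Union>i\<in>{1..2}. A i)" unfolding two by simp
    ultimately show ?case by blast
  next
    case (step m)
    then obtain EE P where N: "plane_net EE P" "\<Union>EE = (\<Union>i\<in>{1..m}. A i)" by auto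
    let ?k = "Suc m"
    have chord: "A ?k \<inter> \<Union>EE = {a ?k, b ?k}" using chords[of ?k] step N(2) by simp
    have arc: "arc_between (A ?k) (a ?k) (b ?k)" using arcs[of ?k] step by simp
    have ends: "a ?k \<in> \<Union>EE" "b ?k \<in> \<Union>EE" using chord by blast+
    obtain EE1 where N1: "plane_net EE1 (insert (a ?k) P)" "\<Union>EE1 = \<Union>EE"
      using plane_net_refine[OF N(1) ends(1)] by blast
    have "b ?k \<in> \<Union>EE1" using ends(2) unfolding N1(2) .
    then obtain EE2 where N2: "plane_net EE2 (insert (b ?k) (insert (a ?k) P))" "\<Union>EE2 = \<Union>EE1"
      using plane_net_refine[OF N1(1)] by blast
    have "plane_net (insert (A ?k) EE2) (insert (b ?k) (insert (a ?k) P))"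
      using chord unfolding N1(2)[symmetric] N2(2)[symmetric]
      by (intro plane_net.chord[OF N2(1) arc]) simp_all
    moreover have "\<Union>(insert (A ?k) EE2) = (\<Union>i\<in>{1..?k}. A i)"
      unfolding Union_insert N2(2) N1(2) N(2) by (simp add: atLeastAtMostSuc_conv)
    ultimately show ?case by blast
  qed
  then show ?thesis using n by simp
qed

lemma arc_between_homeomorphic_image:
  fixes A :: "'a::t2_space set" and h :: "'a \<Rightarrow> 'b::t2_space"
  assumes "arc_between A a b" "continuous_on UNIV h" "inj h"
  shows "arc_between (h ` A) (h a) (h b)"
proof -
  obtain g where g: "arc g" "path_image g = A" "pathstart g = a" "pathfinish g = b"
    using assms(1) arc_between_iff_arc by blast
  have "path (h \<circ> g)"
    using g(1) assms(2) by (intro path_continuous_image) (auto simp: arc_imp_path intro: continuous_on_subset)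
  moreover have "inj_on (h \<circ> g) {0..1}"
    using g(1) assms(3) by (intro comp_inj_on) (auto simp: arc_def intro: inj_on_subset)
  ultimately have "arc (h \<circ> g)" by (simp add: arc_def)
  moreover have "path_image (h \<circ> g) = h ` A" using g(2) by (simp add: path_image_compose)
  ultimately show ?thesis
    using g(3,4) arc_between_iff_arc by (metis pathstart_compose pathfinish_compose)
qed

lemma network_image_plane_net:
  assumes "network E" "continuous_on UNIV h" "inj (h :: real^2 \<Rightarrow> complex)"
  shows "\<exists>EE P. plane_net EE P \<and> \<Union>EE = h ` E"
proof -
  from assms(1) obtain n and A :: "nat \<Rightarrow> (real^2) set" and a b where
    n: "2 \<le> n" and arcs: "\<forall>i\<in>{1..n}. arc_between (A i) (a i) (b i)"
    and E: "E = (\<Union>i\<in>{1..n}. A i)"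
    and circle: "(A 1 \<union> A 2) homeomorphic sphere (0::real^2) 1"
    and chords: "\<forall>k\<in>{2..n}. A k \<inter> (\<Union>i\<in>{1..k - 1}. A i) = {a k, b k}"
    unfolding network_def by (elim exE conjE)
  have "A 2 \<inter> A 1 = {a 2, b 2}" using bspec[OF chords, of 2] n by simp
  then have "A 1 \<inter> A 2 = {a 2, b 2}" by (simp only: Int_commute)
  moreover have "arc_between (A 1) (a 1) (b 1)" "arc_between (A 2) (a 2) (b 2)"
    using arcs n by simp_all
  ultimately have first: "arc_between (A 1) (a 2) (b 2)"
    using circle_arcs_same_ends circle by metis
  have "\<exists>EE P. plane_net EE P \<and> \<Union>EE = (\<Union>i\<in>{1..n}. h ` A i)"
  proof (rule plane_net_of_arcs[where a = "\<lambda>i. h (a i)" and b = "\<lambda>i. h (b i)", OF n])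
    show "arc_between (h ` A i) (h (a i)) (h (b i))" if "i \<in> {1..n}" for i
      using arcs that by (intro arc_between_homeomorphic_image assms) simp
    show "arc_between (h ` A 1) (h (a 2)) (h (b 2))"
      by (intro arc_between_homeomorphic_image assms first)
    show "h ` A k \<inter> (\<Union>i\<in>{1..k - 1}. h ` A i) = {h (a k), h (b k)}" if "k \<in> {2..n}" for k
    proof -
      have "h ` A k \<inter> (\<Union>i\<in>{1..k - 1}. h ` A i) = h ` (A k \<inter> (\<Union>i\<in>{1..k - 1}. A i))"
        unfolding image_Int[OF assms(3)] image_UN ..
      also have "\<dots> = {h (a k), h (b k)}" unfolding bspec[OF chords that] by simp
      finally show ?thesis .
    qed
  qed
  moreover have "h ` E = (\<Union>i\<in>{1..n}. h ` A i)" unfolding E by (rule image_UN)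
  ultimately show ?thesis by simp
qed

section \<open>Functions that are discontinuous exactly on a network\<close>

theorem theorem43:
  fixes f :: "real^2 \<Rightarrow> real"
  assumes "\<forall>x. f x \<in> {0..}"
    and "closedin (top_of_set (UNIV \<times> {0..})) (graph_of f)"
    and "network (discontinuities f)"
  shows "\<not> connected (graph_of f)"
proof -
  \<comment> \<open>Jordan's and Janiszewski's theorems concern the complex plane.\<close>
  have "DIM(complex) = DIM(real^2)" by simp
  then obtain h :: "complex \<Rightarrow> real^2" and k where
    lin: "linear h" "linear k" and inv: "\<And>x. k (h x) = x" "\<And>y. h (k y) = y"
    by (rule isomorphisms_UNIV_UNIV) blast
  have cont: "continuous_on UNIV h" "continuous_on UNIV k"
    using lin by (auto intro: linear_continuous_on simp: linear_conv_bounded_linear)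
  then have isC: "isCont h x" "isCont k y" for x y
    by (simp_all add: continuous_on_eq_continuous_at)
  have "inj k" using inv(2) by (metis injI)
  then obtain EE P where net: "plane_net EE P" "\<Union>EE = k ` discontinuities f"
    using network_image_plane_net[OF assms(3) cont(2)] by blast
  have "isCont (f \<circ> h) x \<longleftrightarrow> isCont f (h x)" for x
  proof
    assume "isCont (f \<circ> h) x"
    then have "isCont (f \<circ> h) (k (h x))" by (simp only: inv)
    then have "isCont (\<lambda>y. (f \<circ> h) (k y)) (h x)" by (rule isCont_o2[OF isC(2)])
    then show "isCont f (h x)" by (simp add: inv)
  next
    assume "isCont f (h x)"
    then have "isCont (\<lambda>x. f (h x)) x" by (rule isCont_o2[OF isC(1)])
    then show "isCont (f \<circ> h) x" by (simp only: o_def)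
  qed
  then have "x \<in> discontinuities (f \<circ> h) \<longleftrightarrow> h x \<in> discontinuities f" for x
    unfolding discontinuities_def by blast
  then have "discontinuities (f \<circ> h) = h -` discontinuities f" by blast
  also have "h -` S = k ` S" for S
    by (intro set_eqI iffI) (auto simp: inv intro: image_eqI[of _ k "h _"])
  finally have disc: "discontinuities (f \<circ> h) = k ` discontinuities f" .
  have "closed ((UNIV :: (real^2) set) \<times> {0::real..})" by (intro closed_Times) auto
  then have "closed (graph_of f)" using assms(2) closedin_closed_trans by blast
  moreover have "graph_of (f \<circ> h) = (\<lambda>(x,y). (h x, y)) -` graph_of f"
    using inv by (auto simp: graph_of_def) 
  moreover have "continuous_on UNIV (\<lambda>(x,y::real). (h x, y))"
    unfolding split_beta using cont(1) by (intro continuous_intros continuous_on_compose2[OF cont(1)]) auto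
  ultimately have "closed (graph_of (f \<circ> h))" using closed_vimage by metis
  then interpret closed_graph_net "f \<circ> h" EE P
    using assms(1) net disc by unfold_locales auto
  show ?thesis
  proof
    assume conn: "connected (graph_of f)"
    have "continuous_on (graph_of f) (\<lambda>(x,y). (k x, y))"
      unfolding split_beta using cont(2) by (intro continuous_intros continuous_on_compose2[OF cont(2)]) auto
    then have "connected ((\<lambda>(x,y). (k x, y)) ` graph_of f)"
      using conn by (rule connected_continuous_image)
    moreover have "(\<lambda>(x,y). (k x, y)) ` graph_of f = graph_of (f \<circ> h)"
    proof -
      have "(x, f (h x)) \<in> (\<lambda>(x,y). (k x, y)) ` graph_of f" for x
        by (rule image_eqI[of _ _ "(h x, f (h x))"]) (simp_all add: inv graph_of_def)
      then show ?thesis using inv by (auto simp: graph_of_def)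
    qed
    ultimately show False using graph_not_connected by simp
  qed
qed

end
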